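(* For $n\ge 0$ let $\mathsf{gc}(n)=|\mathscr{R}_{\mathrm{GC}}(n)|$ be the number of Gelfand--Cetlin type reduced words of $w_0^{(n+1)}$. Then $\mathsf{gc}(0)=\mathsf{gc}(1)=1$, and for $n\ge 2$, \[ \mathsf{gc}(n)=\sum_{i=1}^{n} g^{(n,n-1,\dots,n-i+1)}\,\mathsf{gc}(n-i), \] where $g^{\mu}$ denotes the number of standard Young tableaux of shifted shape $\mu$, given explicitly for $\mu=(\mu_1,\dots,\mu_t)$ by \[ g^{\mu}=\frac{|\mu|!}{\mu_1!\mu_2!\cdots\mu_t!}\prod_{i<j}\frac{\mu_i-\mu_j}{\mu_i+\mu_j}. \]
   Context: Let $\mathfrak{S}_{n+1}$ be the symmetric group on $[n+1]=\{1,\dots,n+1\}$ and $s_i=(i,i+1)$, $i\in[n]$. A word $(i_1,\dots,i_r)$ of $w$ (i.e. $w=s_{i_1}\cdots s_{i_r}$) is reduced if $r$ is minimal; $\mathscr{R}(w)$ is the set of reduced words of $w$. $w_0^{(n+1)}$ is the longest element of $\mathfrak{S}_{n+1}$ (one-line notation $n+1\,n\,\cdots\,1$), of length $\bar n=n(n+1)/2$. A word poset is a finite poset $P$ with a function $f_P:P\to\mathbb{Z}_{>0}$ (an element $x$ is "in column $f_P(x)$"); $P\sim Q$ (isomorphic) if there is a poset isomorphism $\phi:P\to Q$ with $f_Q\circ\phi=f_P$. For $\mathbf i=(i_1,\dots,i_\ell)\in\mathscr R(w)$, $P_{\mathbf i}$ is the poset on $[\ell]$ which is the reflexive transitive closure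 of the relations $j<k$ for all $j<k$ with $|i_j-i_k|=1$, with $f_{P_{\mathbf i}}(j)=i_j$. $\mathcal P(w)$ denotes the set of word posets isomorphic to some $P_{\mathbf i}$, $\mathbf i\in\mathscr R(w)$. For $P\in\mathcal P(w_0^{(n+1)})$ there is a unique chain $\mathsf D(P)=\{d_1<_P\cdots<_P d_n\}$ with $f_P(d_i)=n+1-i$ (descending chain) and a unique chain $\mathsf A(P)=\{a_1<_P\cdots<_P a_n\}$ with $f_P(a_i)=i$ (ascending chain). Define $\mathrm{ind}_{\mathsf D}(P)=\sum_{i=1}^n\#\{k\in P: k>_P d_i,\ f_P(k)=f_P(d_i)\}$ and $\mathrm{ind}_{\mathsf A}(P)=\sum_{i=1}^n\#\{k\in P: k>_P a_i,\ f_P(k)=f_P(a_i)\}$. Let $I_{\mathsf D}(P)=\{k\in P: k<_P d_i \text{ and } f_P(k)=f_P(d_i)\text{ for some } i\}$ and $I_{\mathsf A}(P)=\{k\in P: k<_P a_i\text{ and } f_P(k)=f_P(a_i)\text{ for some } i\}$. The $\mathsf D$-contraction $C_{\mathsf D}(P)$ is $P\setminus\mathsf D(P)$ with the induced order and $f_{C_{\mathsf D}(P)}(k)=f_P(k)$ if $k\in I_{\mathsf D}(P)$, $f_P(k)-1$ otherwise. The $\mathsf A$-contraction $C_{\mathsf A}(P)$ is $P\setminus\mathsf A(P)$ with the induced order and $f_{C_{\mathsf A}(P)}(k)=f_P(k)-1$ if $k\in I_{\mathsf A}(P)$, $f_P(k)$ otherwise. Both contractions lie in $\mathcal P(w_0^{(n)})$.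 For $\delta=(\delta_1,\dots,\delta_{n-1})\in\{\mathsf A,\mathsf D\}^{n-1}$, the $\delta$-index of $P$ is $\mathrm{ind}_\delta(P)=(I_1,\dots,I_{n-1})$ with $I_k=\mathrm{ind}_{\delta_k}(C_{\delta_{k+1}}\circ\cdots\circ C_{\delta_{n-1}}(P))$ (so $I_{n-1}=\mathrm{ind}_{\delta_{n-1}}(P)$). $P$ is of Gelfand--Cetlin type if $\mathrm{ind}_\delta(P)=(0,\dots,0)$ for some $\delta$; a reduced word $\mathbf i\in\mathscr R(w_0^{(n+1)})$ is of Gelfand--Cetlin type if $P_{\mathbf i}$ is. $\mathscr R_{\mathrm{GC}}(n)$ is the set of Gelfand--Cetlin type reduced words in $\mathscr R(w_0^{(n+1)})$ (for $n\le1$ every reduced word is counted, the case $n=0$ being the empty word). For a strict partition $\mu=(\mu_1>\dots>\mu_t>0)$, the shifted diagram is $\{(i,j):1\le i\le t,\ i\le j\le \mu_i+i-1\}$, and a standard Young tableau of shifted shape $\mu$ is a bijection $T$ from it to $[|\mu|]$ that is increasing along rows and columns. *)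

theory Defs
  imports Complex_Main "HOL-Library.FuncSet" "HOL-Combinatorics.Permutations"
begin

section \<open>Reduced words\<close>

text \<open>The group \<open>\<SS>\<^bsub>n+1\<^esub>\<close> consists of the permutations of \<open>{1..n+1}\<close>, extended
  by the identity to all of \<^typ>\<open>nat\<close>; \<open>s\<^sub>i\<close> is \<^term>\<open>transpose i (i + 1)\<close>.
  Words are lists, so the letter \<open>i\<^sub>j\<close> of a word \<open>is\<close> is \<open>is ! (j - 1)\<close>.\<close>

definition word_prod :: "nat list \<Rightarrow> nat \<Rightarrow> nat" where
  "word_prod is = foldr (\<lambda>i w. transpose i (i + 1) \<circ> w) is id"

definition words_of :: "nat \<Rightarrow> (nat \<Rightarrow> nat) \<Rightarrow> nat list set" where
  "words_of n w = {is. set is \<subseteq> {1..n} \<and> word_prod is = w}"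

definition reduced_words :: "nat \<Rightarrow> (nat \<Rightarrow> nat) \<Rightarrow> nat list set" where
  "reduced_words n w =
     {is \<in> words_of n w. \<forall>js \<in> words_of n w. length is \<le> length js}"

definition longest_perm :: "nat \<Rightarrow> nat \<Rightarrow> nat" where
  "longest_perm m = (\<lambda>i. if i \<in> {1..m} then m + 1 - i else i)"


section \<open>Word posets\<close>

text \<open>\<open>wp_ord\<close> is the non-strict order on \<open>wp_elems\<close>, and \<open>wp_col\<close> is the function
  \<open>f\<^sub>P\<close>, relevant on \<open>wp_elems\<close> only.\<close>

record 'a word_poset =
  wp_elems :: "'a set"
  wp_ord :: "('a \<times> 'a) set"
  wp_col :: "'a \<Rightarrow> nat"

definition wp_less :: "'a word_poset \<Rightarrow> 'a \<Rightarrow> 'a \<Rightarrow> bool" where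
  "wp_less P x y \<longleftrightarrow> (x, y) \<in> wp_ord P \<and> x \<noteq> y"

definition poset_of_word :: "nat list \<Rightarrow> nat word_poset" where
  "poset_of_word is =
     (let E = {1..length is};
          R = {(j, k). j \<in> E \<and> k \<in> E \<and> j < k \<and>
                       \<bar>int (is ! (j - 1)) - int (is ! (k - 1))\<bar> = 1}
      in \<lparr>wp_elems = E, wp_ord = R\<^sup>* \<inter> E \<times> E, wp_col = (\<lambda>j. is ! (j - 1))\<rparr>)"


section \<open>Chains, indices and contractions\<close>

text \<open>\<open>Asc\<close> and \<open>Desc\<close> stand for the letters \<open>\<A>\<close> and \<open>\<D>\<close>. In what follows the
  argument \<open>n\<close> is the rank: the word poset is meant to come from a reduced word of the
  longest element of \<open>\<SS>\<^bsub>n+1\<^esub>\<close>.\<close>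

datatype direction = Asc | Desc

fun chain_columns :: "direction \<Rightarrow> nat \<Rightarrow> nat list" where
  "chain_columns Asc n = [1..<n + 1]"
| "chain_columns Desc n = rev [1..<n + 1]"

definition is_dir_chain :: "direction \<Rightarrow> nat \<Rightarrow> 'a word_poset \<Rightarrow> 'a list \<Rightarrow> bool" where
  "is_dir_chain d n P xs \<longleftrightarrow>
     set xs \<subseteq> wp_elems P \<and> sorted_wrt (wp_less P) xs \<and> map (wp_col P) xs = chain_columns d n"

text \<open>The chain is listed in increasing order. It exists and is unique for the word posets
  of the longest element of \<open>\<SS>\<^bsub>n+1\<^esub>\<close>.\<close>

definition dir_chain :: "direction \<Rightarrow> nat \<Rightarrow> 'a word_poset \<Rightarrow> 'a list" where
  "dir_chain d n P = (THE xs. is_dir_chain d n P xs)"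

definition dir_ind :: "direction \<Rightarrow> nat \<Rightarrow> 'a word_poset \<Rightarrow> nat" where
  "dir_ind d n P =
     (\<Sum>x\<leftarrow>dir_chain d n P. card {k \<in> wp_elems P. wp_less P x k \<and> wp_col P k = wp_col P x})"

definition below_chain :: "direction \<Rightarrow> nat \<Rightarrow> 'a word_poset \<Rightarrow> 'a set" where
  "below_chain d n P =
     {k \<in> wp_elems P. \<exists>x \<in> set (dir_chain d n P). wp_less P k x \<and> wp_col P k = wp_col P x}"

fun contracted_col :: "direction \<Rightarrow> nat \<Rightarrow> 'a word_poset \<Rightarrow> 'a \<Rightarrow> nat" where
  "contracted_col Asc n P k =
     (if k \<in> below_chain Asc n P then wp_col P k - 1 else wp_col P k)"
| "contracted_col Desc n P k =
     (if k \<in> below_chain Desc n P then wp_col P k else wp_col P k - 1)"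

definition contraction :: "direction \<Rightarrow> nat \<Rightarrow> 'a word_poset \<Rightarrow> 'a word_poset" where
  "contraction d n P =
     (let E = wp_elems P - set (dir_chain d n P)
      in \<lparr>wp_elems = E, wp_ord = wp_ord P \<inter> E \<times> E, wp_col = contracted_col d n P\<rparr>)"

text \<open>For \<open>\<delta> = (\<delta>\<^sub>1, \<dots>, \<delta>\<^bsub>n-1\<^esub>)\<close>, the letter \<open>\<delta>\<^sub>j\<close> is \<open>\<delta> ! (j - 1)\<close>, and the contraction
  \<open>C\<close> for \<open>\<delta>\<^sub>j\<close> takes a word poset of rank \<open>j + 1\<close> to one of rank \<open>j\<close>. Hence
  \<^term>\<open>iterated_contraction \<delta> n k P\<close> is
  \<open>(C\<^bsub>\<delta>(k+1)\<^esub> \<circ> \<dots> \<circ> C\<^bsub>\<delta>(n-1)\<^esub>) P\<close> and has rank \<open>k + 1\<close>.\<close>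

definition iterated_contraction ::
    "direction list \<Rightarrow> nat \<Rightarrow> nat \<Rightarrow> 'a word_poset \<Rightarrow> 'a word_poset" where
  "iterated_contraction \<delta> n k P =
     foldr (\<lambda>j. contraction (\<delta> ! (j - 1)) (j + 1)) [k + 1..<n] P"

definition delta_index :: "direction list \<Rightarrow> nat \<Rightarrow> 'a word_poset \<Rightarrow> nat list" where
  "delta_index \<delta> n P =
     map (\<lambda>k. dir_ind (\<delta> ! (k - 1)) (k + 1) (iterated_contraction \<delta> n k P)) [1..<n]"

text \<open>For \<open>n \<le> 1\<close> the list \<open>\<delta>\<close> is empty and the condition holds vacuously, in accordance
  with the convention that then every reduced word is of Gelfand--Cetlin type.\<close>

definition gelfand_cetlin_type :: "nat \<Rightarrow> 'a word_poset \<Rightarrow> bool" where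
  "gelfand_cetlin_type n P \<longleftrightarrow>
     (\<exists>\<delta>. length \<delta> = n - 1 \<and> delta_index \<delta> n P = replicate (n - 1) 0)"

definition gc_words :: "nat \<Rightarrow> nat list set" where
  "gc_words n =
     {is \<in> reduced_words n (longest_perm (n + 1)). gelfand_cetlin_type n (poset_of_word is)}"

definition gc :: "nat \<Rightarrow> nat" where
  "gc n = card (gc_words n)"


section \<open>Standard Young tableaux of shifted shape\<close>

text \<open>The part \<open>\<mu>\<^sub>i\<close> is \<open>\<mu> ! (i - 1)\<close>.\<close>

definition strict_partition :: "nat list \<Rightarrow> bool" where
  "strict_partition \<mu> \<longleftrightarrow> sorted_wrt (>) \<mu> \<and> (\<forall>m \<in> set \<mu>. 0 < m)"

definition shifted_diagram :: "nat list \<Rightarrow> (nat \<times> nat) set" where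
  "shifted_diagram \<mu> = {(i, j). 1 \<le> i \<and> i \<le> length \<mu> \<and> i \<le> j \<and> j \<le> \<mu> ! (i - 1) + i - 1}"

definition shifted_syt :: "nat list \<Rightarrow> (nat \<times> nat \<Rightarrow> nat) set" where
  "shifted_syt \<mu> =
     {T \<in> extensional (shifted_diagram \<mu>).
        bij_betw T (shifted_diagram \<mu>) {1..sum_list \<mu>} \<and>
        (\<forall>i j j'. (i, j) \<in> shifted_diagram \<mu> \<longrightarrow> (i, j') \<in> shifted_diagram \<mu> \<longrightarrow> j < j' \<longrightarrow>
           T (i, j) < T (i, j')) \<and>
        (\<forall>i i' j. (i, j) \<in> shifted_diagram \<mu> \<longrightarrow> (i', j) \<in> shifted_diagram \<mu> \<longrightarrow> i < i' \<longrightarrow>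
           T (i, j) < T (i', j))}"

definition num_shifted_syt :: "nat list \<Rightarrow> nat" where
  "num_shifted_syt \<mu> = card (shifted_syt \<mu>)"

end

theory Submission
  imports Defs "HOL-Library.Multiset" "HOL-Computational_Algebra.Polynomial"
begin

text \<open>A chain of index zero consists of the maxima of all columns, so it can be moved to the
  end of the word by commutations.  Hence the Gelfand--Cetlin type words of rank \<open>n\<close> are the
  words commutation equivalent to \<open>u (n, \<dots>, 1)\<close> or \<open>u\<^sup>+ (1, \<dots>, n)\<close>, where \<open>u\<close> is such a
  word of rank \<open>n - 1\<close> and \<open>u\<^sup>+\<close> is \<open>u\<close> with all letters shifted by one; the two cases are
  exchanged by \<open>c \<mapsto> n + 1 - c\<close>.  Group these words by the last change of direction.  When an
  ascending chain \<open>1, \<dots>, m\<close> is followed by descending chains from \<open>m + 1, \<dots>, n\<close>, its top letter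
  \<open>m\<close> separates what comes before from what comes after, so the word is a Gelfand--Cetlin type word
  of rank \<open>m\<close> followed by a linear extension of the shifted diagram \<open>(n, \<dots>, m + 1)\<close>, read
  backwards.  The words, the tableaux, and the product formula satisfy the same recursion on the
  removal of corners; for the product this is a Lagrange interpolation identity.\<close>

section \<open>Commutation classes of words\<close>

text \<open>The summand for \<open>m = 0\<close> goes back to rank one. From rank two on, the flip
  exchanges two disjoint halves of \<open>gc_set\<close>, so \<open>gc m\<close> is twice the number
  of words ending in an ascending chain. In rank one the two halves coincide; there the doubled
  summand splits into those for \<open>m = 1\<close> and \<open>m = 0\<close>, whose tableau counts
  agree. The definitions speak of posets, with chains given by a definite description and with
  contractions that are not of the form \<open>poset_of_word\<close>. Posets are therefore followed
  up to a labelling by the positions of a word. Existence and uniqueness of chains become statements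
  about subwords, and only descending chains are analysed directly. The interpolation nodes come
  from a symmetry: the factor by which lowering a part \<open>z\<close> changes its quotients is
  invariant under \<open>z\<close> to \<open>1 - z\<close>, hence a function of
  \<open>z (z - 1)\<close>.\<close>

definition pair_filter :: "nat \<Rightarrow> nat list \<Rightarrow> nat list" where
  "pair_filter c w = filter (\<lambda>x. x = c \<or> x = Suc c) w"

text \<open>Two words are related by commutations of non-adjacent letters iff they have the same
  restriction to each pair of consecutive letters; see \<open>comm_eq_induct\<close> for the nontrivial
  direction.\<close>

definition comm_eq :: "nat list \<Rightarrow> nat list \<Rightarrow> bool" (infix "\<approx>" 50) where
  "w \<approx> w' \<longleftrightarrow> (\<forall>c. pair_filter c w = pair_filter c w')"

text \<open>Equal letters are not adjacent: exchanging them leaves the word as it is, so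
  \<open>\<not> adj a b\<close> is exactly the condition for a swap.\<close>

definition adj :: "nat \<Rightarrow> nat \<Rightarrow> bool" where
  "adj a b \<longleftrightarrow> a = Suc b \<or> b = Suc a"

lemma adj_sym: "adj a b \<longleftrightarrow> adj b a"
  by (auto simp: adj_def)

lemma pair_filter_simps [simp]:
  "pair_filter c [] = []"
  "pair_filter c (x # w) = (if x = c \<or> x = Suc c then x # pair_filter c w else pair_filter c w)"
  "pair_filter c (u @ v) = pair_filter c u @ pair_filter c v"
  by (auto simp: pair_filter_def)

lemma set_pair_filter: "set (pair_filter c w) = set w \<inter> {c, Suc c}"
  by (auto simp: pair_filter_def)

lemma comm_eq_refl [simp]: "w \<approx> w"
  by (simp add: comm_eq_def)

lemma comm_eq_sym: "w \<approx> w' \<Longrightarrow> w' \<approx> w"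
  by (simp add: comm_eq_def)

lemma comm_eq_trans [trans]: "u \<approx> v \<Longrightarrow> v \<approx> w \<Longrightarrow> u \<approx> w"
  by (simp add: comm_eq_def)

lemma comm_eq_append: "u \<approx> u' \<Longrightarrow> v \<approx> v' \<Longrightarrow> u @ v \<approx> u' @ v'"
  by (simp add: comm_eq_def)

lemma comm_eq_Cons: "u \<approx> u' \<Longrightarrow> c # u \<approx> c # u'"
  by (simp add: comm_eq_def)

text \<open>Restriction to a pair distributes over \<open>@\<close>, so cancellation is free; for a
  closure under swaps it would need an argument of its own.\<close>

lemma comm_eq_append_cancel: "u @ v \<approx> u' @ v \<longleftrightarrow> u \<approx> u'"
  by (simp add: comm_eq_def)

lemma comm_eq_rev: "rev u \<approx> rev v \<longleftrightarrow> u \<approx> v"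
  by (simp add: comm_eq_def pair_filter_def flip: rev_filter)

lemma comm_eq_mset: assumes "w \<approx> w'" shows "mset w = mset w'"
proof (rule multiset_eqI)
  fix c
  have *: "count (mset v) c = count (mset (pair_filter c v)) c" for v
    by (induction v) auto
  show "count (mset w) c = count (mset w') c"
    using assms * by (metis comm_eq_def)
qed

lemma comm_eq_length: "w \<approx> w' \<Longrightarrow> length w = length w'"
  using comm_eq_mset mset_eq_length by blast

lemma comm_eq_set: "w \<approx> w' \<Longrightarrow> set w = set w'"
  using comm_eq_mset mset_eq_setD by blast

lemma comm_eq_swap: "\<not> adj a b \<Longrightarrow> x @ a # b # y \<approx> x @ b # a # y"
  by (auto simp: comm_eq_def adj_def)

lemma comm_eq_move: "(\<And>z. z \<in> set y \<Longrightarrow> \<not> adj c z) \<Longrightarrow> c # y \<approx> y @ [c]"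
proof (induction y)
  case (Cons z y)
  have "c # z # y \<approx> z # c # y"
    using comm_eq_swap[of c z "[]" y] Cons.prems by simp
  also have "\<dots> \<approx> z # y @ [c]"
    using Cons by (intro comm_eq_Cons) auto
  finally show ?case by simp
qed simp

text \<open>Split \<open>w'\<close> at its last \<open>c\<close>. For every pair of consecutive
  letters containing \<open>c\<close>, the restriction of \<open>w'\<close> ends in
  \<open>c\<close>, so no neighbour of \<open>c\<close> can follow.\<close>

lemma comm_eq_snocE:
  assumes "w @ [c] \<approx> w'"
  obtains x y where "w' = x @ c # y" "w \<approx> x @ y" "\<And>z. z \<in> set y \<Longrightarrow> z \<noteq> c \<and> \<not> adj c z"
proof -
  have "c \<in> set w'" using comm_eq_set[OF assms] by auto
  then obtain x y where w': "w' = x @ c # y" and y: "c \<notin> set y"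
    by (meson split_list_last)
  have empty: "pair_filter d y = []" if d: "c = d \<or> c = Suc d" for d
  proof (rule ccontr)
    assume ne: "pair_filter d y \<noteq> []"
    have "pair_filter d (w @ [c]) = pair_filter d w'" using assms by (simp add: comm_eq_def)
    hence "pair_filter d w @ [c] = pair_filter d x @ c # pair_filter d y"
      using d w' by auto
    hence "c = last (pair_filter d y)"
      using ne by (metis last_ConsR last_appendR last_snoc list.distinct(1))
    with ne y show False using last_in_set[OF ne] by (simp add: set_pair_filter)
  qed
  have far: "z \<noteq> c \<and> \<not> adj c z" if "z \<in> set y" for z
  proof -
    have "z \<noteq> Suc c"
      using empty[of c] that set_pair_filter[of c y] by auto
    moreover have "c \<noteq> Suc z"
      using empty[of z] that set_pair_filter[of z y] by auto
    ultimately show ?thesis using y that by (auto simp: adj_def)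
  qed
  have "w @ [c] \<approx> x @ y @ [c]"
    using assms w' comm_eq_append[OF comm_eq_refl comm_eq_move[of y c], of x] far
      comm_eq_trans by blast
  hence "w \<approx> x @ y"
    using comm_eq_append_cancel[of w "[c]" "x @ y"] by simp
  thus thesis using that w' far by blast
qed

text \<open>Swaps past letters not adjacent to it bring the last letter \<open>c\<close> of
  \<open>w'\<close> to the end of \<open>w\<close>. The rest is induction for the predicate
  \<open>\<lambda>v. Q (v @ [c])\<close>, which is why \<open>Q\<close> is generalised.\<close>

lemma comm_eq_induct [consumes 1, case_names base swap]:
  assumes "w \<approx> w'" "Q w"
    and "\<And>x a b y. \<not> adj a b \<Longrightarrow> Q (x @ a # b # y) \<Longrightarrow> Q (x @ b # a # y)"
  shows "Q w'"
  using assms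
proof (induction w' arbitrary: w Q rule: rev_induct)
  case Nil
  thus ?case using comm_eq_length[of w "[]"] by simp
next
  case (snoc c w')
  obtain x y where w: "w = x @ c # y" "w' \<approx> x @ y" "\<And>z. z \<in> set y \<Longrightarrow> z \<noteq> c \<and> \<not> adj c z"
    using comm_eq_snocE[OF comm_eq_sym[OF snoc.prems(1)]] by blast
  have "Q (x @ y @ [c])"
    using w(3) snoc.prems(2) unfolding w(1)
  proof (induction y arbitrary: x)
    case (Cons z y)
    have "Q ((x @ [z]) @ c # y)"
      using snoc.prems(3)[of c z x y] Cons.prems by simp
    from Cons.IH[OF _ this] Cons.prems(1) show ?case by simp
  qed simp
  hence "Q ((x @ y) @ [c])" by simp
  moreover have "Q ((u @ b # a # v) @ [c])" if "\<not> adj a b" "Q ((u @ a # b # v) @ [c])" for u a b v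
    using snoc.prems(3)[of a b u "v @ [c]"] that by simp
  ultimately show ?case
    using snoc.IH[of "x @ y" "\<lambda>v. Q (v @ [c])"] comm_eq_sym[OF w(2)] by blast
qed

section \<open>Reduced words of the longest element\<close>

lemma word_prod_simps [simp]:
  "word_prod [] = id"
  "word_prod (c # w) = transpose c (Suc c) \<circ> word_prod w"
  by (simp_all add: word_prod_def)

lemma word_prod_append: "word_prod (u @ v) = word_prod u \<circ> word_prod v"
  by (induction u) (simp_all add: comp_assoc)

lemma bij_word_prod: "bij (word_prod w)"
proof (induction w)
  case Nil
  show "bij (word_prod [])" by simp
next
  case (Cons c w)
  thus "bij (word_prod (c # w))" by (simp add: bij_comp)
qed

lemma transpose_comm:
  assumes "\<not> adj a b"
  shows "transpose a (Suc a) \<circ> transpose b (Suc b) = transpose b (Suc b) \<circ> transpose a (Suc a)"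
  using assms by (auto simp: fun_eq_iff transpose_def adj_def)

lemma word_prod_swap:
  assumes "\<not> adj a b"
  shows "word_prod (x @ a # b # y) = word_prod (x @ b # a # y)"
  using transpose_comm[OF assms] by (simp add: word_prod_append fun_eq_iff)

lemma word_prod_comm_eq: "w \<approx> w' \<Longrightarrow> word_prod w = word_prod w'"
  by (erule comm_eq_induct[where Q = "\<lambda>v. word_prod w = word_prod v"])
    (use word_prod_swap in \<open>auto simp del: word_prod_simps\<close>)

section \<open>Length as the number of inversions\<close>

definition inversions :: "(nat \<Rightarrow> nat) \<Rightarrow> (nat \<times> nat) set" where
  "inversions v = {(i, j). i < j \<and> v j < v i}"

text \<open>Composing on the left exchanges the values \<open>c\<close> and \<open>c + 1\<close>. No
  value lies between them, so only the comparison of their positions changes.\<close>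

lemma inversions_step:
  assumes v: "bij v" "v a = c" "v b = Suc c" "a < b"
  shows "inversions (transpose c (Suc c) \<circ> v) = insert (a, b) (inversions v)"
    and "(a, b) \<notin> inversions v"
proof -
  have a: "v x = c \<longleftrightarrow> x = a" and b: "v x = Suc c \<longleftrightarrow> x = b" for x
    using v by (metis bij_pointE)+
  have "(i, j) \<in> inversions (transpose c (Suc c) \<circ> v) \<longleftrightarrow> (i, j) \<in> insert (a, b) (inversions v)"
    for i j
    using a[of i] a[of j] b[of i] b[of j] v(4)
    by (auto simp: inversions_def transpose_def split: if_splits)
  thus "inversions (transpose c (Suc c) \<circ> v) = insert (a, b) (inversions v)" by auto
  show "(a, b) \<notin> inversions v" using v by (auto simp: inversions_def)
qed

lemma inversions_step':
  assumes v: "bij v" "v a = c" "v b = Suc c" "b < a"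
  shows "inversions v = insert (b, a) (inversions (transpose c (Suc c) \<circ> v))"
    and "(b, a) \<notin> inversions (transpose c (Suc c) \<circ> v)"
proof -
  have "transpose c (Suc c) \<circ> (transpose c (Suc c) \<circ> v) = v"
    by (simp add: fun_eq_iff)
  thus "inversions v = insert (b, a) (inversions (transpose c (Suc c) \<circ> v))"
    "(b, a) \<notin> inversions (transpose c (Suc c) \<circ> v)"
    using inversions_step[of "transpose c (Suc c) \<circ> v" b c a] v
    by (simp_all add: bij_comp)
qed

lemma inversions_word_prod:
  "finite (inversions (word_prod w)) \<and> card (inversions (word_prod w)) \<le> length w"
proof (induction w)
  case (Cons c w)
  let ?v = "word_prod w"
  obtain a b where ab: "?v a = c" "?v b = Suc c"
    using bij_word_prod[of w] by (metis bij_pointE)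
  consider "a < b" | "b < a" using ab by (metis less_linear n_not_Suc_n)
  thus ?case
  proof cases
    case 1
    have "finite (inversions (word_prod (c # w))) \<and>
        card (inversions (word_prod (c # w))) \<le> length (c # w)"
      using inversions_step[OF bij_word_prod ab 1] Cons.IH by simp
    thus ?thesis .
  next
    case 2
    have "inversions (word_prod (c # w)) \<subseteq> inversions ?v"
      using inversions_step'[OF bij_word_prod ab 2] by auto
    with Cons.IH show ?thesis
      by (metis card_mono finite_subset le_SucI le_trans length_Cons)
  qed
next
  case Nil
  have "inversions (word_prod []) = {}" by (auto simp: inversions_def)
  thus ?case by (simp del: word_prod_simps)
qed

text \<open>The inversion count replaces minimality over all words: in this form the property passes
  to suffixes by \<open>reduced_ConsD\<close>. For the longest element
  \<open>reduced_words_longest\<close> reconciles the two.\<close>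

definition reduced :: "nat list \<Rightarrow> bool" where
  "reduced w \<longleftrightarrow> card (inversions (word_prod w)) = length w"

text \<open>In the opposite order of positions, prepending \<open>c\<close> would remove an
  inversion, and the count would stay at most \<open>length w\<close>.\<close>

lemma reduced_ConsD:
  assumes "reduced (c # w)"
  shows "reduced w"
    and "word_prod w a = c \<Longrightarrow> word_prod w b = Suc c \<Longrightarrow> a < b"
proof -
  obtain a' b' where ab: "word_prod w a' = c" "word_prod w b' = Suc c"
    using bij_word_prod[of w] by (metis bij_pointE)
  have lt: "a' < b'"
  proof (rule ccontr)
    assume "\<not> a' < b'"
    with ab have ba: "b' < a'" by (metis less_linear n_not_Suc_n)
    have "inversions (word_prod (c # w)) \<subseteq> inversions (word_prod w)"
      using inversions_step'[OF bij_word_prod ab ba] by auto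
    hence "card (inversions (word_prod (c # w))) \<le> length w"
      using inversions_word_prod[of w] by (meson card_mono le_trans)
    with assms show False by (simp add: reduced_def)
  qed
  show "reduced w"
    using inversions_step[OF bij_word_prod ab lt] assms inversions_word_prod[of w]
    by (simp add: reduced_def)
  show "word_prod w a = c \<Longrightarrow> word_prod w b = Suc c \<Longrightarrow> a < b"
    using lt ab bij_word_prod[of w] by (metis bij_pointE)
qed

lemma card_inversions_longest_perm:
  "card (inversions (longest_perm m)) = m * (m - 1) div 2"
proof -
  have eq: "inversions (longest_perm m) = {(i, j). 1 \<le> i \<and> i < j \<and> j \<le> m}"
    by (auto simp: inversions_def longest_perm_def split: if_splits)
  have "card {(i, j). 1 \<le> i \<and> i < j \<and> j \<le> m} = m * (m - 1) div 2 \<and>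
      finite {(i, j). 1 \<le> i \<and> i < j \<and> j \<le> m}" for m :: nat
  proof (induction m)
    case (Suc m)
    have "{(i, j). 1 \<le> i \<and> i < j \<and> j \<le> Suc m} =
        {(i, j). 1 \<le> i \<and> i < j \<and> j \<le> m} \<union> (\<lambda>i. (i, Suc m)) ` {1..m}"
      by (auto simp: le_Suc_eq)
    moreover have "card ({(i, j). 1 \<le> i \<and> i < j \<and> j \<le> m} \<union> (\<lambda>i. (i, Suc m)) ` {1..m}) =
        m * (m - 1) div 2 + m"
      using Suc by (subst card_Un_disjoint) (auto simp: card_image inj_on_def)
    moreover have "m * (m - 1) div 2 + m = Suc m * (Suc m - 1) div 2"
      by (cases m) auto
    ultimately show ?case using Suc by auto
  next
    case 0
    have "{(i, j). 1 \<le> i \<and> i < j \<and> j \<le> (0::nat)} = {}" by auto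
    thus ?case by (metis card.empty finite.emptyI div_0 mult_0)
  qed
  thus ?thesis using eq by simp
qed

section \<open>Words of the longest element\<close>

definition desc :: "nat \<Rightarrow> nat list" where
  "desc n = rev [1..<Suc n]"

lemma desc_simps [simp]: "desc 0 = []" "desc (Suc n) = Suc n # desc n"
  by (simp_all add: desc_def)

lemma length_desc [simp]: "length (desc n) = n"
  by (simp add: desc_def)

lemma set_desc [simp]: "set (desc n) = {1..n}"
  by (auto simp: desc_def)

lemma word_prod_desc:
  "word_prod (desc n) x = (if x = 1 then Suc n else if 2 \<le> x \<and> x \<le> Suc n then x - 1 else x)"
  by (induction n) (auto simp: transpose_def)

text \<open>The chain \<open>n, ..., 1\<close> sends \<open>1\<close> to \<open>n + 1\<close> and
  lowers \<open>2, ..., n + 1\<close> by one; it remains to reverse \<open>{1..n}\<close>. So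
  appending a chain raises the rank of a word of the longest element by one.\<close>

lemma longest_perm_Suc: "longest_perm (Suc n) = longest_perm n \<circ> word_prod (desc n)"
  by (auto simp: fun_eq_iff longest_perm_def word_prod_desc)

definition w0_words :: "nat \<Rightarrow> nat list set" where
  "w0_words n = {w. set w \<subseteq> {1..n} \<and> word_prod w = longest_perm (Suc n) \<and>
     length w = n * Suc n div 2}"

lemma longest_perm_1: "longest_perm (Suc 0) = id"
  by (auto simp: fun_eq_iff longest_perm_def)

lemma w0_words_0: "w0_words 0 = {[]}"
  by (auto simp: w0_words_def longest_perm_1)

lemma w0_words_length: "w \<in> w0_words n \<Longrightarrow> length w = n * Suc n div 2"
  by (simp add: w0_words_def)

lemma triangle_Suc: "Suc n * Suc (Suc n) div 2 = n * Suc n div 2 + Suc n"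
  by auto

lemma fun_right_cancel: "surj f \<Longrightarrow> g \<circ> f = h \<circ> f \<longleftrightarrow> g = h"
  by (auto simp: fun_eq_iff) (metis surjD)

lemma w0_words_append_desc:
  assumes "set u \<subseteq> {1..n}"
  shows "u @ desc (Suc n) \<in> w0_words (Suc n) \<longleftrightarrow> u \<in> w0_words n"
proof -
  have "word_prod u \<circ> word_prod (desc (Suc n)) = longest_perm (Suc n) \<circ> word_prod (desc (Suc n)) \<longleftrightarrow>
      word_prod u = longest_perm (Suc n)"
    using bij_is_surj[OF bij_word_prod[of "desc (Suc n)"]] fun_right_cancel by blast
  moreover have "set (u @ desc (Suc n)) \<subseteq> {1..Suc n}" using assms by auto
  ultimately show ?thesis
    using assms longest_perm_Suc[of "Suc n"] triangle_Suc[of n]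
    by (auto simp: w0_words_def word_prod_append simp del: desc_simps)
qed

lemma w0_words_nonempty: "w0_words n \<noteq> {}"
proof (induction n)
  case 0
  thus ?case by (simp add: w0_words_0)
next
  case (Suc n)
  then obtain u where "u \<in> w0_words n" by blast
  moreover from this have "set u \<subseteq> {1..n}" by (simp add: w0_words_def)
  ultimately show ?case using w0_words_append_desc by blast
qed

lemma reduced_words_longest: "reduced_words n (longest_perm (n + 1)) = w0_words n"
proof -
  have len: "n * Suc n div 2 \<le> length w" if "w \<in> words_of n (longest_perm (n + 1))" for w
    using that inversions_word_prod[of w] card_inversions_longest_perm[of "n + 1"]
    by (auto simp: words_of_def mult.commute)
  have w0_words_iff: "w \<in> w0_words n \<longleftrightarrow>
      w \<in> words_of n (longest_perm (n + 1)) \<and> length w = n * Suc n div 2" for w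
    by (simp add: w0_words_def words_of_def)
  obtain u where u: "u \<in> words_of n (longest_perm (n + 1))" "length u = n * Suc n div 2"
    using w0_words_nonempty w0_words_iff by blast
  have "length w = n * Suc n div 2 \<longleftrightarrow>
      (\<forall>js\<in>words_of n (longest_perm (n + 1)). length w \<le> length js)"
    if "w \<in> words_of n (longest_perm (n + 1))" for w
    using that len u by (metis le_antisym)
  thus ?thesis
    unfolding reduced_words_def using w0_words_iff by blast
qed

lemma w0_words_reduced: "w \<in> w0_words n \<Longrightarrow> reduced w"
  using card_inversions_longest_perm[of "Suc n"]
  by (simp add: w0_words_def reduced_def mult.commute)

lemma w0_words_comm_eq: "w \<approx> w' \<Longrightarrow> w \<in> w0_words n \<Longrightarrow> w' \<in> w0_words n"
  using word_prod_comm_eq comm_eq_set comm_eq_length by (auto simp: w0_words_def)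

text \<open>Otherwise the first \<open>c\<close> commutes up to the second and both cancel, so a
  word shorter by two has the same product.\<close>

lemma adj_between:
  assumes "reduced (x @ c # y @ c # z)"
  shows "\<exists>d\<in>set y. adj c d"
proof (rule ccontr)
  assume "\<not> ?thesis"
  hence "c # y \<approx> y @ [c]" by (intro comm_eq_move) auto
  hence "x @ (c # y) @ (c # z) \<approx> x @ (y @ [c]) @ (c # z)"
    by (intro comm_eq_append) auto
  hence "word_prod (x @ c # y @ c # z) = word_prod (x @ y @ c # c # z)"
    using word_prod_comm_eq by fastforce
  also have "\<dots> = word_prod (x @ y @ z)"
    by (simp add: word_prod_append fun_eq_iff)
  finally show False
    using assms inversions_word_prod[of "x @ y @ z"] by (simp add: reduced_def)
qed

section \<open>The symmetry reversing the order of the letters\<close>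

definition flip :: "nat \<Rightarrow> nat \<Rightarrow> nat" where
  "flip n c = Suc n - c"

lemma map_flip_flip: "set w \<subseteq> {1..n} \<Longrightarrow> map (flip n) (map (flip n) w) = w"
  by (induction w) (auto simp: flip_def)

lemma set_map_flip: "set w \<subseteq> {1..n} \<Longrightarrow> set (map (flip n) w) \<subseteq> {1..n}"
  by (force simp: flip_def)

lemma comm_eq_flip:
  assumes "w \<approx> w'" "set w \<subseteq> {1..n}"
  shows "map (flip n) w \<approx> map (flip n) w'"
proof -
  \<comment> \<open>The flip carries the letters \<open>n - c\<close> and \<open>n - c + 1\<close>
    to \<open>c + 1\<close> and \<open>c\<close>; for \<open>c > n\<close> no flipped letter is
    \<open>c\<close> or \<open>c + 1\<close>.\<close>
  have *: "pair_filter c (map (flip n) v) =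
      (if c \<le> n then map (flip n) (pair_filter (n - c) v) else [])"
    if "set v \<subseteq> {1..n}" for c v
    using that by (induction v) (auto simp: flip_def)
  have "set w' \<subseteq> {1..n}" using assms comm_eq_set by blast
  with assms show ?thesis by (simp add: comm_eq_def *)
qed

text \<open>Reversing \<open>{1..n+1}\<close> carries the transposition of \<open>c\<close> and
  \<open>c + 1\<close> to that of \<open>n + 2 - c\<close> and \<open>n + 1 - c\<close>, so the flip
  is conjugation by the longest element.\<close>

lemma word_prod_flip:
  assumes "set w \<subseteq> {1..n}"
  shows "word_prod (map (flip n) w) = longest_perm (Suc n) \<circ> word_prod w \<circ> longest_perm (Suc n)"
  using assms
proof (induction w)
  case Nil
  show ?case by (auto simp: fun_eq_iff longest_perm_def)
next
  case (Cons c w)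
  have c: "1 \<le> c" "c \<le> n" using Cons.prems by auto
  have "transpose (flip n c) (Suc (flip n c)) (longest_perm (Suc n) x) =
      longest_perm (Suc n) (transpose c (Suc c) x)" for x
    using c unfolding flip_def longest_perm_def transpose_def
    by (simp split: if_split) linarith
  moreover have "word_prod (map (flip n) w) x =
      longest_perm (Suc n) (word_prod w (longest_perm (Suc n) x))" for x
    using Cons by simp
  ultimately show "word_prod (map (flip n) (c # w)) =
      longest_perm (Suc n) \<circ> word_prod (c # w) \<circ> longest_perm (Suc n)"
    by (intro ext) simp
qed

lemma w0_words_flip:
  assumes "w \<in> w0_words n" shows "map (flip n) w \<in> w0_words n"
proof -
  have "longest_perm (Suc n) \<circ> longest_perm (Suc n) = id"
    by (auto simp: fun_eq_iff longest_perm_def)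
  thus ?thesis
    using assms word_prod_flip[of w n] set_map_flip[of w n] by (auto simp: w0_words_def comp_assoc)
qed

section \<open>The unique descending subword\<close>

text \<open>In the wiring diagram of \<open>w\<close>, the wire that starts at height \<open>h\<close> only goes down and ends at
  height \<open>1\<close>.\<close>

fun descends :: "nat \<Rightarrow> nat list \<Rightarrow> bool" where
  "descends h [] \<longleftrightarrow> h = 1"
| "descends h (c # w) \<longleftrightarrow> c \<noteq> h \<and> (if Suc c = h then descends c w else descends h w)"

lemma descends_0: "\<not> descends 0 w"
  by (induction w) auto

lemma word_prod_0: "0 \<notin> set w \<Longrightarrow> word_prod w 0 = 0"
  by (induction w) (auto simp: transpose_def)

text \<open>A letter \<open>h\<close> met at height \<open>h\<close> would lift the wire: the
  remaining word would send \<open>1\<close> to \<open>h + 1\<close> and, by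
  \<open>reduced_ConsD\<close>, some point below \<open>1\<close> to \<open>h\<close>. But
  \<open>0\<close> is fixed, as it is not a letter.\<close>

lemma reduced_descends:
  "reduced w \<Longrightarrow> 0 \<notin> set w \<Longrightarrow> word_prod w 1 = h \<Longrightarrow> descends h w"
proof (induction w arbitrary: h)
  case (Cons c w)
  have "c \<noteq> h"
  proof
    assume "c = h"
    hence "word_prod w 1 = Suc c"
      using Cons.prems(3) by (auto simp: transpose_def split: if_splits)
    moreover obtain a where a: "word_prod w a = c"
      using bij_word_prod[of w] by (metis bij_pointE)
    ultimately have "a < 1" using reduced_ConsD(2)[OF Cons.prems(1)] by blast
    thus False using a Cons.prems(2) word_prod_0[of w] by auto
  qed
  moreover have "word_prod w 1 = (if Suc c = h then c else h)"
    using Cons.prems(3) \<open>c \<noteq> h\<close> by (auto simp: transpose_def split: if_splits)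
  ultimately show ?case
    using Cons.IH reduced_ConsD(1)[OF Cons.prems(1)] Cons.prems(2) by auto
qed simp

text \<open>Positions are recorded rather than a subword, because uniqueness of a chain concerns its
  elements and equal subwords may sit at different positions.\<close>

definition embeds :: "'a list \<Rightarrow> 'a list \<Rightarrow> nat list \<Rightarrow> bool" where
  "embeds w ys ps \<longleftrightarrow>
     sorted_wrt (<) ps \<and> set ps \<subseteq> {..<length w} \<and> map ((!) w) ps = ys"

lemma embeds_Nil [simp]: "embeds [] ys ps \<longleftrightarrow> ys = [] \<and> ps = []"
  by (auto simp: embeds_def)

lemma embeds_Nil2: "embeds w [] ps \<longleftrightarrow> ps = []"
  by (auto simp: embeds_def)

lemma embeds_Cons:
  "embeds (c # w) ys ps \<longleftrightarrow> (\<exists>qs. embeds w ys qs \<and> ps = map Suc qs) \<or>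
     (\<exists>qs ys'. ys = c # ys' \<and> embeds w ys' qs \<and> ps = 0 # map Suc qs)"
proof
  have shift: "\<exists>rs. embeds w (map ((!) (c # w)) qs) rs \<and> qs = map Suc rs"
    if "sorted_wrt (<) qs" "set qs \<subseteq> {..<length (c # w)}" "0 \<notin> set qs" for qs
  proof -
    have pos: "x > 0" if "x \<in> set qs" for x using \<open>0 \<notin> set qs\<close> that by (metis gr0I)
    have "sorted_wrt (<) (map (\<lambda>x. x - 1) qs)"
      unfolding sorted_wrt_map by (rule sorted_wrt_mono_rel[OF _ that(1)]) (use pos in force)
    moreover have "set (map (\<lambda>x. x - 1) qs) \<subseteq> {..<length w}"
      using that(2) pos by fastforce
    ultimately show ?thesis
      using pos by (intro exI[of _ "map (\<lambda>x. x - 1) qs"])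
        (auto simp: embeds_def intro!: map_idI[symmetric])
  qed
  assume e: "embeds (c # w) ys ps"
  show "(\<exists>qs. embeds w ys qs \<and> ps = map Suc qs) \<or>
     (\<exists>qs ys'. ys = c # ys' \<and> embeds w ys' qs \<and> ps = 0 # map Suc qs)"
  proof (cases "0 \<in> set ps")
    case False
    then obtain rs where "embeds w ys rs" "ps = map Suc rs"
      using shift[of ps] e unfolding embeds_def by blast
    thus ?thesis by blast
  next
    case True
    then obtain p qs where ps: "ps = p # qs" by (cases ps) auto
    with True e have p: "p = 0" "0 \<notin> set qs" by (auto simp: embeds_def)
    have "\<exists>rs. embeds w (map ((!) (c # w)) qs) rs \<and> qs = map Suc rs"
      using e ps p by (intro shift) (auto simp: embeds_def)
    moreover have "ys = c # map ((!) (c # w)) qs" using e ps p by (auto simp: embeds_def)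
    ultimately show ?thesis using ps p by blast
  qed
next
  assume "(\<exists>qs. embeds w ys qs \<and> ps = map Suc qs) \<or>
     (\<exists>qs ys'. ys = c # ys' \<and> embeds w ys' qs \<and> ps = 0 # map Suc qs)"
  thus "embeds (c # w) ys ps"
    by (auto simp: embeds_def sorted_wrt_map)
qed

text \<open>Before the wire leaves height \<open>h\<close> no letter \<open>h\<close> occurs; once
  it has dropped to \<open>h - 1\<close>, by induction not even the tail
  \<open>h - 1, ..., 1\<close> can be found.\<close>

lemma descends_no_embed: "descends h w \<Longrightarrow> \<not> embeds w (desc h) ps"
proof (induction w arbitrary: h ps)
  case (Cons c w)
  obtain k where h: "h = Suc k" using Cons.prems descends_0 by (cases h) auto
  show ?case
  proof (cases "Suc c = h")
    case True
    have "\<not> embeds w (desc c) qs" for qs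
      using Cons True by auto
    moreover have "\<not> embeds w (desc h) qs" for qs
    proof
      assume "embeds w (desc h) qs"
      then have "embeds w (desc k) (tl qs)" by (cases qs) (auto simp: embeds_def h)
      thus False using True h \<open>\<And>qs. \<not> embeds w (desc c) qs\<close> by auto
    qed
    ultimately show ?thesis using True h by (auto simp: embeds_Cons)
  next
    case False
    have "descends h w" using Cons.prems False by auto
    hence "\<not> embeds w (desc (Suc k)) qs" for qs using Cons.IH h by blast
    moreover have "c \<noteq> h" using Cons.prems by simp
    ultimately show ?thesis using h by (auto simp: embeds_Cons)
  qed
qed auto

text \<open>The letters at which the wire goes down form the only such subword: skipping one of them
  would leave a subword \<open>h, \<dots>, 1\<close> for a wire that is already at height \<open>h\<close>.\<close>

lemma descends_embeds_unique: "descends h w \<Longrightarrow> \<exists>!ps. embeds w (desc (h - 1)) ps"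
proof (induction w arbitrary: h)
  case (Cons c w)
  obtain k where h: "h = Suc k" using Cons.prems descends_0 by (cases h) auto
  show ?case
  proof (cases "Suc c = h")
    case True
    hence d: "descends c w" and "c = k" using Cons.prems h by auto
    then obtain k' where k: "k = Suc k'" using descends_0 by (cases k) auto
    have "\<exists>!ps. embeds w (desc k') ps"
      using Cons.IH[OF d] \<open>c = k\<close> k by simp
    then obtain ps where ps: "\<And>qs. embeds w (desc k') qs \<longleftrightarrow> qs = ps"
      by (elim ex1E) blast
    have "desc (h - 1) = c # desc k'" using \<open>c = k\<close> k h by simp
    moreover have "\<not> embeds w (c # desc k') qs" for qs
      using descends_no_embed[OF d, of qs] \<open>c = k\<close> k by simp
    ultimately have "embeds (c # w) (desc (h - 1)) qs \<longleftrightarrow> qs = 0 # map Suc ps" for qs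
      using ps by (simp add: embeds_Cons)
    thus ?thesis by simp
  next
    case False
    hence d: "descends h w" using Cons.prems by auto
    have "\<exists>!ps. embeds w (desc k) ps" using Cons.IH[OF d] h by simp
    then obtain ps where ps: "\<And>qs. embeds w (desc k) qs \<longleftrightarrow> qs = ps"
      by (elim ex1E) blast
    have "desc k \<noteq> c # ys" for ys using False h by (cases k) auto
    hence "embeds (c # w) (desc (h - 1)) qs \<longleftrightarrow> qs = map Suc ps" for qs
      using ps h by (simp add: embeds_Cons)
    thus ?thesis by simp
  qed
qed (auto simp: embeds_Nil2)

text \<open>The first chain letter \<open>h - 1\<close> is the largest letter and does not recur, so
  only smaller letters follow and induction applies to them. Letters before it are at most
  \<open>h - 2\<close> and simply join \<open>u\<close>.\<close>

lemma extract_desc: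
  assumes "descends h w" "\<And>x. x \<in> set w \<Longrightarrow> x < h" "embeds w (desc (h - 1)) ps"
    and "\<And>p k. p \<in> set ps \<Longrightarrow> p < k \<Longrightarrow> k < length w \<Longrightarrow> w ! k \<noteq> w ! p"
  shows "\<exists>u. w \<approx> u @ desc (h - 1) \<and> (\<forall>x\<in>set u. Suc x < h)"
  using assms
proof (induction w arbitrary: h ps)
  case (Cons c w)
  obtain k where h: "h = Suc k" using Cons.prems descends_0 by (cases h) auto
  show ?case
  proof (cases "Suc c = h")
    case True
    hence d: "descends c w" and "c = k" using Cons.prems h by auto
    then obtain k' where k: "k = Suc k'" using descends_0 by (cases k) auto
    obtain qs where qs: "embeds w (desc k') qs" "ps = 0 # map Suc qs"
      using Cons.prems(3) descends_no_embed[OF d] \<open>c = k\<close> k h by (auto simp: embeds_Cons)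
    have c: "c \<notin> set w"
      using Cons.prems(4)[of 0] qs(2) by (force simp: in_set_conv_nth)
    have "\<exists>u. w \<approx> u @ desc (c - 1) \<and> (\<forall>x\<in>set u. Suc x < c)"
    proof (rule Cons.IH[OF d])
      show "x < c" if "x \<in> set w" for x
        using that c Cons.prems(2)[of x] \<open>c = k\<close> h by (cases "x = c") auto
      show "embeds w (desc (c - 1)) qs" using qs \<open>c = k\<close> k by simp
      show "w ! k \<noteq> w ! p" if "p \<in> set qs" "p < k" "k < length w" for p k
        using Cons.prems(4)[of "Suc p" "Suc k"] that qs(2) by auto
    qed
    then obtain u where u: "w \<approx> u @ desc (c - 1)" "\<forall>x\<in>set u. Suc x < c" by blast
    have "c # w \<approx> (c # u) @ desc (c - 1)" using comm_eq_Cons[OF u(1)] by simp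
    \<comment> \<open>The letters of \<open>u\<close> are at most \<open>c - 2\<close>, so
      \<open>c\<close> passes them.\<close>
    also have "\<dots> \<approx> (u @ [c]) @ desc (c - 1)"
      using u(2) by (intro comm_eq_append comm_eq_move) (auto simp: adj_def)
    finally have "c # w \<approx> u @ desc (h - 1)" using \<open>c = k\<close> k h by simp
    thus ?thesis using u(2) True by fastforce
  next
    case False
    hence d: "descends h w" using Cons.prems by auto
    have "desc k \<noteq> c # ys" for ys using False h by (cases k) auto
    then obtain qs where qs: "embeds w (desc k) qs" "ps = map Suc qs"
      using Cons.prems(3) h by (auto simp: embeds_Cons)
    have "\<exists>u. w \<approx> u @ desc (h - 1) \<and> (\<forall>x\<in>set u. Suc x < h)"
    proof (rule Cons.IH[OF d])
      show "w ! k \<noteq> w ! p" if "p \<in> set qs" "p < k" "k < length w" for p k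
        using Cons.prems(4)[of "Suc p" "Suc k"] that qs(2) by auto
    qed (use qs h Cons.prems(2) in auto)
    then obtain u where u: "w \<approx> u @ desc (h - 1)" "\<forall>x\<in>set u. Suc x < h" by blast
    have "c # w \<approx> (c # u) @ desc (h - 1)" using comm_eq_Cons[OF u(1)] by simp
    moreover have "Suc c < h" using False Cons.prems(2)[of c] by auto
    ultimately show ?thesis using u(2) by (metis set_ConsD)
  qed
qed auto

section \<open>Word posets represented by words\<close>

definition word_rel :: "nat list \<Rightarrow> (nat \<times> nat) set" where
  "word_rel w = {(i, j). i < j \<and> j < length w \<and> adj (w ! i) (w ! j)}"

text \<open>An isomorphism from the poset of \<open>w\<close> to \<open>P\<close>, kept as an
  explicit labelling of positions counted from zero, since contracted posets have other
  carriers.\<close>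

definition represents :: "'a word_poset \<Rightarrow> nat list \<Rightarrow> (nat \<Rightarrow> 'a) \<Rightarrow> bool" where
  "represents P w \<phi> \<longleftrightarrow>
     bij_betw \<phi> {..<length w} (wp_elems P) \<and>
     (\<forall>i<length w. wp_col P (\<phi> i) = w ! i) \<and>
     (\<forall>i<length w. \<forall>j<length w. (\<phi> i, \<phi> j) \<in> wp_ord P \<longleftrightarrow> (i, j) \<in> (word_rel w)\<^sup>*)"

lemma rtrancl_map:
  assumes "\<And>i j. (i, j) \<in> R \<Longrightarrow> (f i, f j) \<in> S" "(i, j) \<in> R\<^sup>*"
  shows "(f i, f j) \<in> S\<^sup>*"
  using assms(2) by (induction rule: rtrancl_induct) (auto dest: assms(1) intro: rtrancl_into_rtrancl)

lemma word_rel_le: "(i, j) \<in> (word_rel w)\<^sup>* \<Longrightarrow> i \<le> j"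
  by (induction rule: rtrancl_induct) (auto simp: word_rel_def)

lemma represents_poset_of_word: "represents (poset_of_word w) w Suc"
proof -
  define R where "R = {(j, k). j \<in> {1..length w} \<and> k \<in> {1..length w} \<and> j < k \<and>
    \<bar>int (w ! (j - 1)) - int (w ! (k - 1))\<bar> = 1}"
  have P: "poset_of_word w = \<lparr>wp_elems = {1..length w},
      wp_ord = R\<^sup>* \<inter> {1..length w} \<times> {1..length w}, wp_col = (\<lambda>j. w ! (j - 1))\<rparr>"
    by (simp add: poset_of_word_def R_def Let_def)
  have to: "(Suc i, Suc j) \<in> R" if "(i, j) \<in> word_rel w" for i j
    using that by (auto simp: word_rel_def R_def adj_def)
  have bwd: "(i - 1, j - 1) \<in> word_rel w" if "(i, j) \<in> R" for i j
    using that unfolding word_rel_def R_def adj_def by auto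
  have "(Suc i, Suc j) \<in> R\<^sup>* \<longleftrightarrow> (i, j) \<in> (word_rel w)\<^sup>*" for i j
    using rtrancl_map[of "word_rel w" Suc R, OF to]
      rtrancl_map[of R "\<lambda>x. x - 1" "word_rel w" "Suc i" "Suc j", OF bwd] by auto
  moreover have "bij_betw Suc {..<length w} {1..length w}"
    by (rule bij_betw_byWitness[of _ "\<lambda>x. x - 1"]) auto
  ultimately show ?thesis by (auto simp: represents_def P)
qed

text \<open>A swap relabels two neighbouring positions, and these are the only two whose order
  changes; as their letters are not adjacent, no link is reversed.\<close>

lemma represents_comm_eq:
  assumes "represents P w \<phi>" "w \<approx> w'"
  shows "\<exists>\<psi>. represents P w' \<psi>"
  using assms(2)
proof (induction rule: comm_eq_induct)
  case base
  show ?case using assms(1) by blast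
next
  case (swap x a b y)
  then obtain \<phi> where \<phi>: "represents P (x @ a # b # y) \<phi>" by blast
  define w where "w = x @ a # b # y"
  define w' where "w' = x @ b # a # y"
  define k where "k = length x"
  define \<tau> where "\<tau> = transpose k (Suc k)"
  have len: "length w' = length w" "Suc k < length w" by (auto simp: w_def w'_def k_def)
  have nth: "w' ! i = w ! \<tau> i" for i
  proof -
    consider "i < k" | "i = k" | "i = Suc k" | d where "i = Suc (Suc (k + d))"
      by (metis add_Suc_right less_imp_Suc_add linorder_neqE_nat not_less_eq)
    thus ?thesis by cases
      (auto simp: w_def w'_def k_def \<tau>_def nth_append transpose_def)
  qed
  have inv: "\<tau> (\<tau> i) = i" for i by (simp add: \<tau>_def)
  have lt: "\<tau> i < length w \<longleftrightarrow> i < length w" for i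
    using len by (auto simp: \<tau>_def transpose_def)
  have ab: "\<not> adj (w ! k) (w ! Suc k)" "\<not> adj (w ! Suc k) (w ! k)"
    using swap(1) adj_sym by (auto simp: w_def k_def nth_append)
  have rel: "(\<tau> i, \<tau> j) \<in> word_rel w" if "(i, j) \<in> word_rel w'" for i j
  proof -
    have ij: "i < j" "j < length w" "adj (w ! \<tau> i) (w ! \<tau> j)"
      using that len by (auto simp: word_rel_def nth)
    have "\<not> (i = k \<and> j = Suc k)" using ij(3) ab by (auto simp: \<tau>_def)
    hence "\<tau> i < \<tau> j" using ij(1) by (auto simp: \<tau>_def transpose_def)
    thus ?thesis using ij lt by (auto simp: word_rel_def)
  qed
  have rel': "(\<tau> i, \<tau> j) \<in> word_rel w'" if "(i, j) \<in> word_rel w" for i j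
  proof -
    have ij: "i < j" "j < length w" "adj (w ! i) (w ! j)"
      using that by (auto simp: word_rel_def)
    have "\<not> (i = k \<and> j = Suc k)" using ij(3) ab by auto
    hence "\<tau> i < \<tau> j" using ij(1) by (auto simp: \<tau>_def transpose_def)
    thus ?thesis using ij lt len by (auto simp: word_rel_def nth inv)
  qed
  have "(i, j) \<in> (word_rel w')\<^sup>* \<longleftrightarrow> (\<tau> i, \<tau> j) \<in> (word_rel w)\<^sup>*" for i j
    using rtrancl_map[of "word_rel w'" \<tau> "word_rel w", OF rel]
      rtrancl_map[of "word_rel w" \<tau> "word_rel w'" "\<tau> i" "\<tau> j", OF rel'] by (auto simp: inv)
  moreover have "bij_betw (\<phi> \<circ> \<tau>) {..<length w'} (wp_elems P)"
  proof (rule bij_betw_trans)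
    show "bij_betw \<tau> {..<length w'} {..<length w}"
      by (rule bij_betw_byWitness[of _ \<tau>]) (auto simp: inv lt len)
    show "bij_betw \<phi> {..<length w} (wp_elems P)"
      using \<phi> by (simp add: represents_def w_def)
  qed
  ultimately have "represents P w' (\<phi> \<circ> \<tau>)"
    using \<phi> unfolding represents_def w_def[symmetric] by (auto simp: nth lt len)
  thus ?case unfolding w'_def by blast
qed

lemma embeds_desc_chain:
  "sorted_wrt (<) ps \<Longrightarrow> set ps \<subseteq> {..<length w} \<Longrightarrow> map ((!) w) ps = desc n \<Longrightarrow>
    sorted_wrt (\<lambda>i j. (i, j) \<in> (word_rel w)\<^sup>*) ps"
proof (induction n arbitrary: ps)
  case (Suc n)
  then obtain p qs where ps: "ps = p # qs" "w ! p = Suc n" "map ((!) w) qs = desc n" by auto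
  have IH: "sorted_wrt (\<lambda>i j. (i, j) \<in> (word_rel w)\<^sup>*) qs"
    using Suc.prems ps by (intro Suc.IH) auto
  have "(p, r) \<in> (word_rel w)\<^sup>*" if r: "r \<in> set qs" for r
  proof (cases qs)
    case (Cons q rs)
    have "w ! q = n" using ps(3) Cons by (cases n) auto
    hence "(p, q) \<in> word_rel w"
      using ps Cons Suc.prems by (auto simp: word_rel_def adj_def)
    moreover have "(q, r) \<in> (word_rel w)\<^sup>*" using r IH Cons by auto
    ultimately show ?thesis by (rule converse_rtrancl_into_rtrancl)
  qed (use r in simp)
  thus ?case using IH ps by simp
qed simp

lemma chain_columns_Desc: "chain_columns Desc n = desc n"
  by (simp add: desc_def)

text \<open>Poset order implies order of positions by \<open>word_rel_le\<close>; conversely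
  consecutive letters of \<open>desc n\<close> are adjacent, so increasing positions carrying them
  are linked.\<close>

lemma is_dir_chain_represents:
  assumes "represents P w \<phi>"
  shows "is_dir_chain Desc n P xs \<longleftrightarrow> (\<exists>ps. embeds w (desc n) ps \<and> xs = map \<phi> ps)"
proof
  have bij: "bij_betw \<phi> {..<length w} (wp_elems P)"
    and col: "\<And>i. i < length w \<Longrightarrow> wp_col P (\<phi> i) = w ! i"
    and ord: "\<And>i j. i < length w \<Longrightarrow> j < length w \<Longrightarrow>
      (\<phi> i, \<phi> j) \<in> wp_ord P \<longleftrightarrow> (i, j) \<in> (word_rel w)\<^sup>*"
    using assms by (auto simp: represents_def)
  {
    assume xs: "is_dir_chain Desc n P xs"
    define ps where "ps = map (inv_into {..<length w} \<phi>) xs"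
    have sub: "set xs \<subseteq> wp_elems P" using xs by (simp add: is_dir_chain_def)
    hence "set xs \<subseteq> \<phi> ` {..<length w}" using bij by (simp add: bij_betw_def)
    hence inv: "inv_into {..<length w} \<phi> x \<in> {..<length w}"
      "\<phi> (inv_into {..<length w} \<phi> x) = x" if "x \<in> set xs" for x
      using that inv_into_into[of x \<phi> "{..<length w}"] f_inv_into_f[of x \<phi> "{..<length w}"]
      by blast+
    have ps: "xs = map \<phi> ps" "set ps \<subseteq> {..<length w}"
      using inv by (auto simp: ps_def intro!: map_idI[symmetric])
    have "sorted_wrt (\<lambda>i j. wp_less P (\<phi> i) (\<phi> j)) ps"
      using xs by (simp add: is_dir_chain_def ps(1) sorted_wrt_map)
    hence "sorted_wrt (<) ps"
    proof (rule sorted_wrt_mono_rel[rotated])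
      fix i j assume "i \<in> set ps" "j \<in> set ps" "wp_less P (\<phi> i) (\<phi> j)"
      thus "i < j" using ord[of i j] word_rel_le[of i j w] ps(2)
        by (auto simp: wp_less_def le_less)
    qed
    moreover have "map ((!) w) ps = desc n"
    proof -
      have "map ((!) w) ps = map (wp_col P) xs" using col ps by auto
      thus ?thesis using xs by (simp add: is_dir_chain_def chain_columns_Desc del: chain_columns.simps)
    qed
    ultimately show "\<exists>ps. embeds w (desc n) ps \<and> xs = map \<phi> ps"
      using ps by (auto simp: embeds_def)
  }
  {
    assume "\<exists>ps. embeds w (desc n) ps \<and> xs = map \<phi> ps"
    then obtain ps where xs: "xs = map \<phi> ps" and ps: "sorted_wrt (<) ps" "set ps \<subseteq> {..<length w}"
      "map ((!) w) ps = desc n" by (auto simp: embeds_def)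
    have "sorted_wrt (\<lambda>i j. (i, j) \<in> (word_rel w)\<^sup>* \<and> i < j) ps"
      using embeds_desc_chain[OF ps] ps(1) by (auto simp: sorted_wrt_iff_nth_less)
    hence "sorted_wrt (\<lambda>i j. wp_less P (\<phi> i) (\<phi> j)) ps"
    proof (rule sorted_wrt_mono_rel[rotated])
      fix i j assume "i \<in> set ps" "j \<in> set ps" "(i, j) \<in> (word_rel w)\<^sup>* \<and> i < j"
      thus "wp_less P (\<phi> i) (\<phi> j)" using ord[of i j] ps(2) bij
        by (auto simp: wp_less_def bij_betw_def inj_on_def subset_iff)
    qed
    moreover have "map (wp_col P) xs = map ((!) w) ps" using xs col ps(2) by auto
    moreover have "set xs \<subseteq> wp_elems P" using xs ps(2) bij by (auto simp: bij_betw_def)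
    ultimately show "is_dir_chain Desc n P xs"
      using ps(3) xs by (simp add: is_dir_chain_def chain_columns_Desc sorted_wrt_map del: chain_columns.simps)
  }
qed

lemma w0_words_descends: "w \<in> w0_words n \<Longrightarrow> descends (Suc n) w"
  by (rule reduced_descends) (auto simp: w0_words_reduced, auto simp: w0_words_def longest_perm_def)

lemma dir_chain_represents:
  assumes "represents P w \<phi>" "w \<in> w0_words n" "embeds w (desc n) ps"
  shows "dir_chain Desc n P = map \<phi> ps"
proof -
  have "\<exists>!ps. embeds w (desc n) ps"
    using descends_embeds_unique[OF w0_words_descends[OF assms(2)]] by simp
  hence "embeds w (desc n) qs \<longleftrightarrow> qs = ps" for qs using assms(3) by blast
  hence "is_dir_chain Desc n P xs \<longleftrightarrow> xs = map \<phi> ps" for xs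
    using is_dir_chain_represents[OF assms(1)] by simp
  thus ?thesis by (simp add: dir_chain_def)
qed

text \<open>By \<open>adj_between\<close> an adjacent letter stands between the two occurrences and
  links them in two steps.\<close>

lemma same_letter_comparable:
  assumes "reduced w" "i < j" "j < length w" "w ! i = w ! j"
  shows "(i, j) \<in> (word_rel w)\<^sup>*"
proof -
  define y where "y = take (j - Suc i) (drop (Suc i) w)"
  have len: "length y = j - Suc i" using assms by (simp add: y_def)
  have "drop (Suc i) w = y @ drop (j - Suc i) (drop (Suc i) w)"
    by (simp add: y_def del: drop_drop)
  also have "drop (j - Suc i) (drop (Suc i) w) = drop j w" using assms by simp
  also have "drop j w = w ! i # drop (Suc j) w" using assms by (simp add: Cons_nth_drop_Suc)
  finally have "w = take i w @ w ! i # y @ w ! i # drop (Suc j) w"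
    using assms id_take_nth_drop[of i w] by simp
  then obtain d where d: "d \<in> set y" "adj (w ! i) d"
    using adj_between[of "take i w" "w ! i" y] assms(1) by metis
  then obtain k where k: "k < j - Suc i" "d = y ! k" by (auto simp: in_set_conv_nth len)
  hence "w ! (Suc i + k) = d" using assms by (simp add: y_def)
  hence "(i, Suc i + k) \<in> word_rel w" "(Suc i + k, j) \<in> word_rel w"
    using k d assms by (auto simp: word_rel_def adj_def)
  thus ?thesis by (meson converse_rtrancl_into_rtrancl r_into_rtrancl)
qed

lemma desc_nth: "i < n \<Longrightarrow> desc n ! i = n - i"
  by (simp add: desc_def rev_nth del: upt_Suc)

lemma embeds_append_desc: "embeds (u @ desc n) (desc n) [length u..<length u + n]"
  by (auto simp: embeds_def nth_append intro: nth_equalityI)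

text \<open>As equal letters are comparable, the summand of a chain element counts the later
  occurrences of its letter. Index zero thus makes every chain position the last of its letter,
  which is what \<open>extract_desc\<close> asks for.\<close>

lemma dir_ind_Desc_eq_0_iff:
  assumes rep: "represents P w \<phi>" and w: "w \<in> w0_words (Suc m)"
  shows "dir_ind Desc (Suc m) P = 0 \<longleftrightarrow> (\<exists>u\<in>w0_words m. w \<approx> u @ desc (Suc m))"
proof -
  \<comment> \<open>Stated for any representing word: one direction uses it for \<open>w\<close>,
    the other for \<open>u @ desc (Suc m)\<close>.\<close>
  have zero: "dir_ind Desc (Suc m) P = 0 \<longleftrightarrow>
      (\<forall>p\<in>set ps. \<forall>k. p < k \<longrightarrow> k < length v \<longrightarrow> v ! k \<noteq> v ! p)"
    if rep: "represents P v \<psi>" and v: "v \<in> w0_words (Suc m)" and ps: "embeds v (desc (Suc m)) ps"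
    for v ps and \<psi> :: "nat \<Rightarrow> 'a"
  proof -
    have bij: "bij_betw \<psi> {..<length v} (wp_elems P)" using rep by (simp add: represents_def)
    have "{k \<in> wp_elems P. wp_less P (\<psi> p) k \<and> wp_col P k = wp_col P (\<psi> p)} =
        \<psi> ` {k. p < k \<and> k < length v \<and> v ! k = v ! p}" (is "?A = ?B")
      if p: "p < length v" for p
    proof -
      have less: "wp_less P (\<psi> p) (\<psi> k) \<longleftrightarrow> p < k"
        if k: "k < length v" "v ! k = v ! p" for k
      proof -
        have "wp_less P (\<psi> p) (\<psi> k) \<longleftrightarrow> (p, k) \<in> (word_rel v)\<^sup>* \<and> p \<noteq> k"
          using rep p k bij by (auto simp: represents_def wp_less_def bij_betw_def inj_on_def)
        thus ?thesis
          using same_letter_comparable[OF w0_words_reduced[OF v], of p k] k word_rel_le[of p k v]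
          by (auto simp: le_less)
      qed
      have "?A = \<psi> ` {k. k < length v \<and> wp_less P (\<psi> p) (\<psi> k) \<and> v ! k = v ! p}"
      proof -
        have "wp_elems P = \<psi> ` {..<length v}" using bij by (simp add: bij_betw_def)
        moreover have "wp_col P (\<psi> i) = v ! i" if "i < length v" for i
          using rep that by (simp add: represents_def)
        ultimately show ?thesis using p by auto
      qed
      also have "\<dots> = ?B" using less by (intro arg_cong[of _ _ "image \<psi>"]) auto
      finally show ?thesis .
    qed
    moreover have "inj_on \<psi> {k. p < k \<and> k < length v \<and> v ! k = v ! p}" for p
      using bij by (auto simp: bij_betw_def inj_on_def)
    moreover have "finite {k. p < k \<and> k < length v \<and> v ! k = v ! p}" for p by simp
    moreover have "p < length v" if "p \<in> set ps" for p using ps that by (auto simp: embeds_def)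
    ultimately show ?thesis
      by (auto simp: dir_ind_def dir_chain_represents[OF rep v ps] card_image sum_list_eq_0_iff)
  qed
  show ?thesis
  proof
    assume 0: "dir_ind Desc (Suc m) P = 0"
    obtain ps where ps: "embeds w (desc (Suc m)) ps"
      using descends_embeds_unique[OF w0_words_descends[OF w]] by auto
    have "\<exists>u. w \<approx> u @ desc (Suc (Suc m) - 1) \<and> (\<forall>x\<in>set u. Suc x < Suc (Suc m))"
      using w0_words_descends[OF w] zero[OF rep w ps] 0 ps w
      by (intro extract_desc[of _ _ ps]) (auto simp: w0_words_def)
    then obtain u where u: "w \<approx> u @ desc (Suc m)" "\<forall>x\<in>set u. x \<le> m"
      by (auto simp: less_Suc_eq_le)
    have "set u \<subseteq> set w" using comm_eq_set[OF u(1)] by auto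
    hence "set u \<subseteq> {1..m}" using u(2) w by (auto simp: w0_words_def)
    thus "\<exists>u\<in>w0_words m. w \<approx> u @ desc (Suc m)"
      using w0_words_append_desc w0_words_comm_eq[OF u(1) w] u(1) by blast
  next
    assume "\<exists>u\<in>w0_words m. w \<approx> u @ desc (Suc m)"
    then obtain u where u: "w \<approx> u @ desc (Suc m)" by blast
    obtain \<psi> where \<psi>: "represents P (u @ desc (Suc m)) \<psi>"
      using represents_comm_eq[OF rep u] by blast
    have "\<forall>p\<in>set [length u..<length u + Suc m]. \<forall>k. p < k \<longrightarrow> k < length (u @ desc (Suc m)) \<longrightarrow>
        (u @ desc (Suc m)) ! k \<noteq> (u @ desc (Suc m)) ! p"
      by (auto simp: nth_append desc_nth simp del: desc_simps)
    thus "dir_ind Desc (Suc m) P = 0"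
      using zero[OF \<psi> w0_words_comm_eq[OF u w] embeds_append_desc] by blast
  qed
qed

text \<open>Each letter of \<open>u\<close> occurs again in the final chain, so all of
  \<open>u\<close> lies below the chain and keeps its column: contraction is truncation of the
  word.\<close>

lemma represents_contraction_Desc:
  assumes rep: "represents P (u @ desc (Suc m)) \<psi>" and u: "u \<in> w0_words m"
  shows "represents (contraction Desc (Suc m) P) u \<psi>"
proof -
  define w where "w = u @ desc (Suc m)"
  have set_u: "set u \<subseteq> {1..m}" using u by (simp add: w0_words_def)
  have w: "w \<in> w0_words (Suc m)" using u w0_words_append_desc[OF set_u] by (simp add: w_def)
  have rep': "represents P w \<psi>" using rep by (simp add: w_def)
  have len: "length w = length u + Suc m" by (simp add: w_def)
  have chain: "dir_chain Desc (Suc m) P = map \<psi> [length u..<length u + Suc m]"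
    using dir_chain_represents[OF rep' w] embeds_append_desc[of u "Suc m"] by (simp add: w_def)
  have bij: "bij_betw \<psi> {..<length w} (wp_elems P)"
    and col: "\<And>i. i < length w \<Longrightarrow> wp_col P (\<psi> i) = w ! i"
    and ord: "\<And>i j. i < length w \<Longrightarrow> j < length w \<Longrightarrow>
      (\<psi> i, \<psi> j) \<in> wp_ord P \<longleftrightarrow> (i, j) \<in> (word_rel w)\<^sup>*"
    using rep' by (auto simp: represents_def)
  have inj: "inj_on \<psi> {..<length w}" using bij by (simp add: bij_betw_def)
  have elems: "wp_elems P - set (dir_chain Desc (Suc m) P) = \<psi> ` {..<length u}"
  proof -
    have "wp_elems P - set (dir_chain Desc (Suc m) P) =
        \<psi> ` {..<length w} - \<psi> ` {length u..<length w}"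
      using bij by (simp add: chain bij_betw_def len del: upt_Suc)
    also have "\<dots> = \<psi> ` ({..<length w} - {length u..<length w})"
      using inj by (subst inj_on_image_set_diff[of \<psi> "{..<length w}"]) auto
    also have "{..<length w} - {length u..<length w} = {..<length u}" using len by auto
    finally show ?thesis .
  qed
  have below: "\<psi> i \<in> below_chain Desc (Suc m) P" if i: "i < length u" for i
  proof -
    have c: "u ! i \<in> {1..m}" using set_u i nth_mem by blast
    \<comment> \<open>Index \<open>i\<close> of \<open>desc (Suc m)\<close> holds
      \<open>Suc m - i\<close>, so this is where the letter \<open>u ! i\<close> occurs in the final
      chain.\<close>
    define k where "k = length u + (Suc m - u ! i)"
    have k: "k < length w" "w ! k = w ! i" "i < k" "k \<in> {length u..<length u + Suc m}"
      using c i by (auto simp: k_def w_def nth_append desc_nth simp del: desc_simps)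
    have "(\<psi> i, \<psi> k) \<in> wp_ord P"
      using same_letter_comparable[OF w0_words_reduced[OF w] k(3,1)] k ord[of i k] by auto
    moreover have "\<psi> i \<noteq> \<psi> k" using inj k by (auto simp: inj_on_def)
    moreover have "\<psi> i \<in> wp_elems P" using bij i len by (auto simp: bij_betw_def)
    moreover have "\<psi> k \<in> set (dir_chain Desc (Suc m) P)" using k(4) by (simp add: chain del: upt_Suc)
    ultimately show ?thesis
      unfolding below_chain_def using col[of i] col[of k] k by (auto simp: wp_less_def)
  qed
  \<comment> \<open>Links go from smaller to larger positions, so a path ending inside
    \<open>u\<close> never leaves it.\<close>
  have rel: "(i, j) \<in> (word_rel w)\<^sup>* \<longleftrightarrow> (i, j) \<in> (word_rel u)\<^sup>*" if j: "j < length u" for i j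
  proof
    assume "(i, j) \<in> (word_rel w)\<^sup>*"
    thus "(i, j) \<in> (word_rel u)\<^sup>*" using j
    proof (induction rule: rtrancl_induct)
      case (step k l)
      have "(k, l) \<in> word_rel u"
        using step.hyps(2) step.prems by (auto simp: word_rel_def w_def nth_append)
      moreover have "k < length u" using calculation step.prems by (auto simp: word_rel_def)
      ultimately show ?case using step.IH by (meson rtrancl_into_rtrancl)
    qed simp
  next
    have "word_rel u \<subseteq> word_rel w" by (auto simp: word_rel_def w_def nth_append)
    thus "(i, j) \<in> (word_rel u)\<^sup>* \<Longrightarrow> (i, j) \<in> (word_rel w)\<^sup>*" using rtrancl_mono by blast
  qed
  have "bij_betw \<psi> {..<length u} (\<psi> ` {..<length u})"
    using inj len by (auto simp: bij_betw_def inj_on_def)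
  moreover have "contracted_col Desc (Suc m) P (\<psi> i) = u ! i" if "i < length u" for i
    using below[OF that] col[of i] that len by (simp add: w_def nth_append)
  moreover have "(\<psi> i, \<psi> j) \<in> wp_ord P \<inter> (\<psi> ` {..<length u}) \<times> (\<psi> ` {..<length u}) \<longleftrightarrow>
      (i, j) \<in> (word_rel u)\<^sup>*" if "i < length u" "j < length u" for i j
    using ord[of i j] rel[OF that(2)] that len by auto
  ultimately show ?thesis
    by (simp add: represents_def contraction_def Let_def elems)
qed

section \<open>Gelfand--Cetlin type reduced words as commutation classes\<close>

definition flip_poset :: "nat \<Rightarrow> 'a word_poset \<Rightarrow> 'a word_poset" where
  "flip_poset n P = P\<lparr>wp_col := \<lambda>x. flip n (wp_col P x)\<rparr>"

lemma flip_poset_simps [simp]: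
  "wp_elems (flip_poset n P) = wp_elems P" "wp_ord (flip_poset n P) = wp_ord P"
  "wp_col (flip_poset n P) x = flip n (wp_col P x)"
  by (simp_all add: flip_poset_def)

lemma wp_less_flip_poset [simp]: "wp_less (flip_poset n P) = wp_less P"
  by (simp add: wp_less_def fun_eq_iff)

lemma flip_eq_iff: "a \<in> {1..n} \<Longrightarrow> b \<in> {1..n} \<Longrightarrow> flip n a = flip n b \<longleftrightarrow> a = b"
  by (auto simp: flip_def)

lemma represents_flip_poset:
  assumes "represents P w \<phi>" "set w \<subseteq> {1..n}"
  shows "represents (flip_poset n P) (map (flip n) w) \<phi>"
proof -
  have "adj (flip n (w ! i)) (flip n (w ! j)) \<longleftrightarrow> adj (w ! i) (w ! j)"
    if "i < length w" "j < length w" for i j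
  proof -
    have "w ! i \<in> {1..n}" "w ! j \<in> {1..n}" using assms(2) that nth_mem by blast+
    thus ?thesis by (auto simp: flip_def adj_def)
  qed
  hence "word_rel (map (flip n) w) = word_rel w" by (auto simp: word_rel_def)
  thus ?thesis using assms(1) by (simp add: represents_def)
qed

lemma map_flip_upt: "map (flip n) [1..<n + 1] = desc n"
  by (rule nth_equalityI) (auto simp: flip_def desc_nth simp del: upt_Suc)

lemma is_dir_chain_Asc:
  assumes "\<And>x. x \<in> wp_elems P \<Longrightarrow> wp_col P x \<in> {1..n}"
  shows "is_dir_chain Asc n P xs \<longleftrightarrow> is_dir_chain Desc n (flip_poset n P) xs"
proof -
  have "map (wp_col P) xs = [1..<n + 1] \<longleftrightarrow> map (\<lambda>x. flip n (wp_col P x)) xs = desc n"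
    if "set xs \<subseteq> wp_elems P"
  proof -
    have rng: "set (map (wp_col P) xs) \<subseteq> {1..n}" "set [1..<n + 1] \<subseteq> {1..n}"
      using that assms by auto
    have "map (\<lambda>x. flip n (wp_col P x)) xs = map (flip n) (map (wp_col P) xs)" by simp
    thus ?thesis using map_flip_flip[OF rng(1)] map_flip_flip[OF rng(2)] map_flip_upt by metis
  qed
  moreover have "map (wp_col (flip_poset n P)) xs = map (\<lambda>x. flip n (wp_col P x)) xs" by simp
  ultimately show ?thesis
    unfolding is_dir_chain_def chain_columns_Desc by (simp del: upt_Suc map_eq_conv) blast
qed

text \<open>The hypothesis \<open>chain\<close> ensures that the definite description returns an
  actual chain; the columns of its elements then lie in \<open>{1..n}\<close>, where
  \<open>flip n\<close> is injective.\<close>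

lemma flip_poset_Asc:
  assumes col: "\<And>x. x \<in> wp_elems P \<Longrightarrow> wp_col P x \<in> {1..n}"
    and chain: "is_dir_chain Desc n (flip_poset n P) (dir_chain Desc n (flip_poset n P))"
  shows "dir_chain Asc n P = dir_chain Desc n (flip_poset n P)"
    and "dir_ind Asc n P = dir_ind Desc n (flip_poset n P)"
    and "below_chain Asc n P = below_chain Desc n (flip_poset n P)"
proof -
  show eq: "dir_chain Asc n P = dir_chain Desc n (flip_poset n P)"
    using is_dir_chain_Asc[of P n, OF col] by (simp add: dir_chain_def)
  have sub: "set (dir_chain Asc n P) \<subseteq> wp_elems P"
    using chain eq by (simp add: is_dir_chain_def)
  have iff: "flip n (wp_col P k) = flip n (wp_col P x) \<longleftrightarrow> wp_col P k = wp_col P x"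
    if "k \<in> wp_elems P" "x \<in> set (dir_chain Asc n P)" for k x
    using that sub col by (intro flip_eq_iff) auto
  show "dir_ind Asc n P = dir_ind Desc n (flip_poset n P)"
    unfolding dir_ind_def eq[symmetric]
    by (intro arg_cong[of _ _ sum_list] map_cong arg_cong[of _ _ card]) (auto simp: iff)
  show "below_chain Asc n P = below_chain Desc n (flip_poset n P)"
    unfolding below_chain_def eq[symmetric] by (auto simp: iff)
qed

lemma represents_col:
  assumes "represents P w \<phi>" "set w \<subseteq> {1..n}" "x \<in> wp_elems P"
  shows "wp_col P x \<in> {1..n}"
proof -
  have "x \<in> \<phi> ` {..<length w}"
    using assms(1,3) by (simp add: represents_def bij_betw_def)
  then obtain i where i: "i < length w" "x = \<phi> i" by auto
  hence "wp_col P x = w ! i" using assms(1) by (simp add: represents_def)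
  thus ?thesis using assms(2) nth_mem[OF i(1)] by auto
qed

lemma w0_words_chain:
  assumes "represents P w \<phi>" "w \<in> w0_words n"
  shows "is_dir_chain Desc n P (dir_chain Desc n P)"
proof -
  obtain ps where ps: "embeds w (desc n) ps"
    using descends_embeds_unique[OF w0_words_descends[OF assms(2)]] by auto
  thus ?thesis
    using is_dir_chain_represents[OF assms(1)] dir_chain_represents[OF assms ps] by blast
qed

lemma w0_words_letters: "w \<in> w0_words n \<Longrightarrow> set w \<subseteq> {1..n}"
  by (simp add: w0_words_def)

lemma dir_ind_Asc:
  assumes rep: "represents P w \<phi>" and w: "w \<in> w0_words n"
  shows "dir_ind Asc n P = dir_ind Desc n (flip_poset n P)"
  using represents_col[OF rep w0_words_letters[OF w]]
    w0_words_chain[OF represents_flip_poset[OF rep w0_words_letters[OF w]] w0_words_flip[OF w]]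
  by (rule flip_poset_Asc(2))

text \<open>The flips of rank \<open>m + 1\<close> before and of rank \<open>m\<close> after the
  contraction differ by one. This turns the descending rule, by which elements below the chain keep
  their column and others lose one, into the ascending rule.\<close>

lemma represents_contraction_Asc:
  assumes rep: "represents P w \<phi>" and w: "w \<in> w0_words (Suc m)"
    and rep': "represents (contraction Desc (Suc m) (flip_poset (Suc m) P)) u \<psi>"
    and u: "set u \<subseteq> {1..m}"
  shows "represents (contraction Asc (Suc m) P) (map (flip m) u) \<psi>"
proof -
  let ?F = "flip_poset (Suc m) P"
  note col = represents_col[OF rep w0_words_letters[OF w]]
  note F = flip_poset_Asc[OF col w0_words_chain[OF represents_flip_poset[OF rep w0_words_letters[OF w]]
      w0_words_flip[OF w]]]
  have "contracted_col Asc (Suc m) P x = flip m (contracted_col Desc (Suc m) ?F x)"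
    if "x \<in> wp_elems P" for x
    using col[OF that] F(3) by (auto simp: flip_def)
  moreover have "wp_elems (contraction Asc (Suc m) P) = wp_elems (contraction Desc (Suc m) ?F)"
    "wp_ord (contraction Asc (Suc m) P) = wp_ord (contraction Desc (Suc m) ?F)"
    by (simp_all add: contraction_def Let_def F(1))
  moreover have "\<psi> i \<in> wp_elems P" if "i < length u" for i
    using rep' that by (auto simp: represents_def contraction_def Let_def bij_betw_def)
  ultimately show ?thesis
    using represents_flip_poset[OF rep' u]
    by (auto simp: represents_def) (auto simp: contraction_def Let_def)
qed

section \<open>Recursive description of the words\<close>

definition desc_ext :: "nat \<Rightarrow> nat list set \<Rightarrow> nat list set" where
  "desc_ext n U = {w. \<exists>u\<in>U. w \<approx> u @ desc n}"

text \<open>Rank one is a base case because \<open>delta_index\<close> tests only ranks from two on.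
  The second half is the ascending case: by \<open>map_flip_gc_set\<close>, the flip of
  \<open>u @ desc n\<close> is a word of \<open>gc_set (n - 1)\<close> with letters raised by one,
  followed by \<open>1, ..., n\<close>.\<close>

fun gc_set :: "nat \<Rightarrow> nat list set" where
  "gc_set 0 = {[]}"
| "gc_set (Suc 0) = {[1]}"
| "gc_set (Suc (Suc m)) =
     desc_ext (Suc (Suc m)) (gc_set (Suc m)) \<union>
     map (flip (Suc (Suc m))) ` desc_ext (Suc (Suc m)) (gc_set (Suc m))"

lemma w0_words_1: "w0_words (Suc 0) = {[1]}"
proof -
  have "word_prod [1] = longest_perm (Suc (Suc 0))"
    by (auto simp: fun_eq_iff longest_perm_def transpose_def)
  thus ?thesis by (auto simp: w0_words_def length_Suc_conv)
qed

lemma gc_set_w0_words: "gc_set n \<subseteq> w0_words n"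
proof (induction n rule: gc_set.induct)
  case (3 m)
  have "w \<in> w0_words (Suc (Suc m))" if "u \<in> gc_set (Suc m)" "w \<approx> u @ desc (Suc (Suc m))" for u w
  proof -
    have "u \<in> w0_words (Suc m)" using that(1) 3 by auto
    hence "u @ desc (Suc (Suc m)) \<in> w0_words (Suc (Suc m))" using w0_words_append_desc w0_words_letters by blast
    thus ?thesis using w0_words_comm_eq comm_eq_sym that(2) by blast
  qed
  thus ?case using w0_words_flip by (auto simp: desc_ext_def simp del: desc_simps)
qed (simp_all add: w0_words_0 w0_words_1)

lemma map_flip_gc_set: "w \<in> gc_set n \<Longrightarrow> map (flip n) w \<in> gc_set n"
proof (induction n rule: gc_set.induct)
  case (3 m)
  let ?n = "Suc (Suc m)"
  let ?D = "desc_ext ?n (gc_set (Suc m))"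
  have "map (flip ?n) (map (flip ?n) v) = v" if "v \<in> ?D" for v
  proof -
    have "v \<in> w0_words ?n" using that gc_set_w0_words[of ?n] by auto
    thus ?thesis by (intro map_flip_flip w0_words_letters)
  qed
  thus ?case using "3.prems" by (auto simp del: map_map)
qed (simp_all add: flip_def)

lemma ex_direction: "(\<exists>d. Q d) \<longleftrightarrow> Q Asc \<or> Q Desc"
proof
  assume "\<exists>d. Q d"
  then obtain d where "Q d" ..
  thus "Q Asc \<or> Q Desc" by (cases d) auto
qed auto

text \<open>\<open>\<delta>\<close> is peeled from its end: its last letter acts first, at full
  rank, and the others form the sequence for the contracted poset.\<close>

lemma gelfand_cetlin_type_Suc:
  "gelfand_cetlin_type (Suc (Suc m)) P \<longleftrightarrow>
     (\<exists>d. dir_ind d (Suc (Suc m)) P = 0 \<and>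
        gelfand_cetlin_type (Suc m) (contraction d (Suc (Suc m)) P))"
proof -
  have step: "delta_index (\<delta> @ [d]) (Suc (Suc m)) P =
      delta_index \<delta> (Suc m) (contraction d (Suc (Suc m)) P) @ [dir_ind d (Suc (Suc m)) P]"
    if len: "length \<delta> = m" for \<delta> d
  proof -
    have it: "iterated_contraction (\<delta> @ [d]) (Suc (Suc m)) k P =
        iterated_contraction \<delta> (Suc m) k (contraction d (Suc (Suc m)) P)"
      if "k \<in> set [1..<Suc m]" for k
    proof -
      have "[k + 1..<Suc (Suc m)] = [k + 1..<Suc m] @ [Suc m]" using that by auto
      hence "iterated_contraction (\<delta> @ [d]) (Suc (Suc m)) k P =
          foldr (\<lambda>j. contraction ((\<delta> @ [d]) ! (j - 1)) (j + 1)) [k + 1..<Suc m]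
            (contraction d (Suc (Suc m)) P)"
        using len by (simp add: iterated_contraction_def nth_append)
      also have "\<dots> = iterated_contraction \<delta> (Suc m) k (contraction d (Suc (Suc m)) P)"
        unfolding iterated_contraction_def using len that
        by (intro foldr_cong refl) (auto simp: nth_append)
      finally show ?thesis .
    qed
    have "[1..<Suc (Suc m)] = [1..<Suc m] @ [Suc m]" by simp
    moreover have "iterated_contraction (\<delta> @ [d]) (Suc (Suc m)) (Suc m) P = P"
      by (simp add: iterated_contraction_def)
    ultimately show ?thesis
      unfolding delta_index_def using it len
      by (auto simp: nth_append simp del: upt_Suc)
  qed
  have zero: "delta_index (\<delta> @ [d]) (Suc (Suc m)) P = replicate (Suc m) 0 \<longleftrightarrow>
      delta_index \<delta> (Suc m) (contraction d (Suc (Suc m)) P) = replicate m 0 \<and>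
      dir_ind d (Suc (Suc m)) P = 0" if "length \<delta> = m" for \<delta> d
    unfolding step[OF that] by (simp flip: replicate_append_same)
  show ?thesis (is "_ = ?R")
  proof
    assume "gelfand_cetlin_type (Suc (Suc m)) P"
    then obtain \<delta>' where \<delta>': "length \<delta>' = Suc m"
      "delta_index \<delta>' (Suc (Suc m)) P = replicate (Suc m) 0"
      unfolding gelfand_cetlin_type_def diff_Suc_1 by blast
    then obtain \<delta> d where "\<delta>' = \<delta> @ [d]" "length \<delta> = m"
      by (auto simp: length_Suc_conv_rev)
    thus ?R using zero \<delta>'(2) unfolding gelfand_cetlin_type_def diff_Suc_1 by blast
  next
    assume ?R
    then obtain d \<delta> where d: "dir_ind d (Suc (Suc m)) P = 0" "length \<delta> = m"
      "delta_index \<delta> (Suc m) (contraction d (Suc (Suc m)) P) = replicate m 0"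
      unfolding gelfand_cetlin_type_def diff_Suc_1 by blast
    thus "gelfand_cetlin_type (Suc (Suc m)) P"
      using zero[OF d(2), of d] unfolding gelfand_cetlin_type_def diff_Suc_1
      by (intro exI[of _ "\<delta> @ [d]"]) (simp del: replicate_Suc)
  qed
qed

lemma gelfand_cetlin_type_iff:
  fixes P :: "'a word_poset"
  shows "represents P w \<phi> \<Longrightarrow> w \<in> w0_words n \<Longrightarrow> gelfand_cetlin_type n P \<longleftrightarrow> w \<in> gc_set n"
proof (induction n arbitrary: P w \<phi> rule: gc_set.induct)
  case 1
  thus ?case by (simp add: gelfand_cetlin_type_def delta_index_def w0_words_0)
next
  case 2
  thus ?case by (simp add: gelfand_cetlin_type_def delta_index_def w0_words_1)
next
  case (3 m)
  let ?k = "Suc m" and ?n = "Suc (Suc m)"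
  \<comment> \<open>The abstract predicate \<open>R\<close> lets this serve twice: for
    \<open>P\<close> itself, and for the flipped poset, where \<open>R\<close> speaks of the
    ascending contraction of \<open>P\<close>.\<close>
  have Desc: "dir_ind Desc ?n Q = 0 \<and> R (contraction Desc ?n Q) \<longleftrightarrow>
      (\<exists>u\<in>gc_set ?k. v \<approx> u @ desc ?n)"
    if Q: "represents Q v \<chi>" "v \<in> w0_words ?n"
      and R: "\<And>u \<psi>. represents (contraction Desc ?n Q) u \<psi> \<Longrightarrow> u \<in> w0_words ?k \<Longrightarrow>
        R (contraction Desc ?n Q) \<longleftrightarrow> u \<in> gc_set ?k"
    for Q :: "'a word_poset" and v \<chi> and R :: "'a word_poset \<Rightarrow> bool"
  proof -
    have iff: "R (contraction Desc ?n Q) \<longleftrightarrow> u \<in> gc_set ?k"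
      if u: "u \<in> w0_words ?k" "v \<approx> u @ desc ?n" for u
      using represents_comm_eq[OF Q(1) u(2)] represents_contraction_Desc[OF _ u(1)] R u(1) by blast
    show ?thesis
      using dir_ind_Desc_eq_0_iff[OF Q] iff gc_set_w0_words[of ?k] by blast
  qed
  let ?F = "flip_poset ?n P"
  note rep = "3.prems"(1) and w = "3.prems"(2)
  note repF = represents_flip_poset[OF rep w0_words_letters[OF w]]
  have D: "dir_ind Desc ?n P = 0 \<and> gelfand_cetlin_type ?k (contraction Desc ?n P) \<longleftrightarrow>
      (\<exists>u\<in>gc_set ?k. w \<approx> u @ desc ?n)"
    using 3(1) by (intro Desc[OF rep w]) blast
  have A: "dir_ind Asc ?n P = 0 \<and> gelfand_cetlin_type ?k (contraction Asc ?n P) \<longleftrightarrow>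
      (\<exists>u\<in>gc_set ?k. map (flip ?n) w \<approx> u @ desc ?n)"
    unfolding dir_ind_Asc[OF rep w]
  proof (rule Desc[OF repF w0_words_flip[OF w], where R = "\<lambda>_. gelfand_cetlin_type ?k (contraction Asc ?n P)"])
    fix u and \<psi> :: "nat \<Rightarrow> 'a"
    assume u: "represents (contraction Desc ?n ?F) u \<psi>" "u \<in> w0_words ?k"
    have "gelfand_cetlin_type ?k (contraction Asc ?n P) \<longleftrightarrow> map (flip ?k) u \<in> gc_set ?k"
      using 3(1)[OF represents_contraction_Asc[OF rep w u(1) w0_words_letters[OF u(2)]] w0_words_flip[OF u(2)]] .
    also have "\<dots> \<longleftrightarrow> u \<in> gc_set ?k"
      using map_flip_gc_set map_flip_flip[OF w0_words_letters[OF u(2)]] by metis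
    finally show "gelfand_cetlin_type ?k (contraction Asc ?n P) \<longleftrightarrow> u \<in> gc_set ?k" .
  qed
  define DD where "DD = desc_ext ?n (gc_set ?k)"
  have set: "gc_set ?n = DD \<union> map (flip ?n) ` DD" by (simp add: DD_def)
  have mem: "w \<in> map (flip ?n) ` DD \<longleftrightarrow> map (flip ?n) w \<in> DD"
  proof
    assume "w \<in> map (flip ?n) ` DD"
    then obtain v where v: "v \<in> DD" "w = map (flip ?n) v" by blast
    have "set v \<subseteq> {1..?n}" using v(1) set gc_set_w0_words[of ?n] w0_words_letters by blast
    thus "map (flip ?n) w \<in> DD" using v map_flip_flip by simp
  next
    assume "map (flip ?n) w \<in> DD"
    thus "w \<in> map (flip ?n) ` DD" using map_flip_flip[OF w0_words_letters[OF w]] by (metis imageI)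
  qed
  have "gelfand_cetlin_type ?n P \<longleftrightarrow>
      (dir_ind Asc ?n P = 0 \<and> gelfand_cetlin_type ?k (contraction Asc ?n P)) \<or>
      (dir_ind Desc ?n P = 0 \<and> gelfand_cetlin_type ?k (contraction Desc ?n P))"
    unfolding gelfand_cetlin_type_Suc ex_direction ..
  also have "\<dots> \<longleftrightarrow> map (flip ?n) w \<in> DD \<or> w \<in> DD"
    unfolding A D by (simp add: DD_def desc_ext_def del: desc_simps)
  also have "\<dots> \<longleftrightarrow> w \<in> gc_set ?n"
    unfolding set Un_iff mem by (rule disj_commute)
  finally show ?case .
qed

lemma gc_words_eq: "gc_words n = gc_set n"
proof -
  have "gelfand_cetlin_type n (poset_of_word w) \<longleftrightarrow> w \<in> gc_set n" if "w \<in> w0_words n" for w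
    by (rule gelfand_cetlin_type_iff[OF represents_poset_of_word that])
  thus ?thesis
    unfolding gc_words_def reduced_words_longest using gc_set_w0_words[of n] by auto
qed

section \<open>Counting by the last change of direction\<close>

definition comm_class :: "nat list \<Rightarrow> nat list set" where
  "comm_class v = {w. w \<approx> v}"

lemma finite_comm_class: "finite (comm_class v)"
proof (rule finite_subset)
  show "comm_class v \<subseteq> {w. set w \<subseteq> set v \<and> length w = length v}"
    using comm_eq_set comm_eq_length by (auto simp: comm_class_def)
qed (simp add: finite_lists_length_eq)

text \<open>The last letter \<open>m\<close> of every word equivalent to \<open>u\<close> lies below all of \<open>v\<close> in the word poset,
  as each letter of \<open>v\<close> is linked to \<open>m\<close> through earlier letters.\<close>

lemma comm_eq_splitE:
  assumes "w \<approx> u @ v" "\<And>u'. u' \<approx> u \<Longrightarrow> u' \<noteq> [] \<and> last u' = m"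
    and "\<And>v1 c v2. v = v1 @ c # v2 \<Longrightarrow> \<exists>x\<in>insert m (set v1). x = c \<or> adj x c"
  shows "\<exists>u' v'. w = u' @ v' \<and> u' \<approx> u \<and> v' \<approx> v"
  using assms(1,3)
proof (induction v arbitrary: w rule: rev_induct)
  case (snoc c v)
  have "(u @ v) @ [c] \<approx> w" using snoc.prems(1) comm_eq_sym by simp
  then obtain x y where w: "w = x @ c # y" and xy: "u @ v \<approx> x @ y"
    and far: "\<And>z. z \<in> set y \<Longrightarrow> z \<noteq> c \<and> \<not> adj c z"
    by (erule comm_eq_snocE)
  obtain u' v' where uv: "x @ y = u' @ v'" "u' \<approx> u" "v' \<approx> v"
    using snoc.IH[OF comm_eq_sym[OF xy]] snoc.prems(2) by (metis append_Cons append_assoc)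
  obtain t where "x = u' @ t \<and> t @ y = v' \<or> u' = x @ t \<and> y = t @ v'"
    using uv(1) by (auto simp: append_eq_append_conv2)
  \<comment> \<open>Were \<open>c\<close> inserted inside \<open>u'\<close>, then \<open>m\<close>
    and all letters of \<open>v\<close> would come after it, although one of them equals
    \<open>c\<close> or is adjacent to it.\<close>
  moreover have "t = []" if t: "u' = x @ t" "y = t @ v'"
  proof (rule ccontr)
    assume "t \<noteq> []"
    hence "last u' \<in> set y" using t by auto
    hence "m \<in> set y" using assms(2)[OF uv(2)] by simp
    moreover have "set v \<subseteq> set y" using comm_eq_set[OF uv(3)] t by auto
    moreover obtain z where "z \<in> insert m (set v)" "z = c \<or> adj z c"
      using snoc.prems(2)[of v c "[]"] by auto
    ultimately show False using far[of z] adj_sym by blast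
  qed
  ultimately obtain t where t: "x = u' @ t" "t @ y = v'" by fastforce
  have "t @ (c # y) \<approx> t @ (y @ [c])"
    using far by (intro comm_eq_append comm_eq_move) auto
  also have "t @ (y @ [c]) = v' @ [c]" using t by simp
  also have "v' @ [c] \<approx> v @ [c]" using uv(3) by (intro comm_eq_append) auto
  finally show ?case using w t(1) uv(2) by (intro exI[of _ u'] exI[of _ "t @ c # y"]) auto
next
  case Nil
  thus ?case by (intro exI[of _ w] exI[of _ "[]"]) simp
qed

definition desc_block :: "nat \<Rightarrow> nat \<Rightarrow> nat list" where
  "desc_block m n = concat (map desc [Suc m..<Suc n])"

lemma desc_block_same [simp]: "desc_block m m = []"
  by (simp add: desc_block_def)

lemma desc_block_Suc: "m \<le> n \<Longrightarrow> desc_block m (Suc n) = desc_block m n @ desc (Suc n)"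
  by (simp add: desc_block_def)

lemma desc_block_split:
  assumes "k \<le> m" "m \<le> n" shows "desc_block k n = desc_block k m @ desc_block m n"
  using assms(2)
proof (induction n rule: dec_induct)
  case (step n)
  thus ?case using assms(1) by (simp add: desc_block_Suc del: desc_simps)
qed simp

lemma desc_split: "desc k = v1 @ c # v2 \<Longrightarrow> (v1 = [] \<and> c = k) \<or> Suc c \<in> set v1"
proof (induction k arbitrary: v1)
  case (Suc k)
  show ?case
  proof (cases v1)
    case (Cons a v)
    thus ?thesis using Suc.IH[of v] Suc.prems by auto
  qed (use Suc.prems in simp)
qed simp

text \<open>Inside a chain each letter comes after its successor; the top letter
  \<open>n + 1\<close> of a chain is adjacent to \<open>n\<close>, which is either \<open>m\<close>
  or the top of the chain before.\<close>

lemma desc_block_chained: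
  "m \<le> n \<Longrightarrow> desc_block m n = v1 @ c # v2 \<Longrightarrow> \<exists>x\<in>insert m (set v1). x = c \<or> adj x c"
proof (induction n arbitrary: v1 v2 rule: dec_induct)
  case (step n)
  have "desc_block m n @ desc (Suc n) = v1 @ c # v2"
    using step.prems step.hyps by (simp add: desc_block_Suc del: desc_simps)
  then consider v where "desc_block m n = v1 @ c # v"
    | v where "v1 = desc_block m n @ v" "desc (Suc n) = v @ c # v2"
  proof -
    assume eq: "desc_block m n @ desc (Suc n) = v1 @ c # v2"
    obtain us where "desc_block m n = v1 @ us \<and> us @ desc (Suc n) = c # v2 \<or>
        desc_block m n @ us = v1 \<and> desc (Suc n) = us @ c # v2"
      using eq by (auto simp only: append_eq_append_conv2)
    thus thesis by (cases us) (use that in fastforce)+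
  qed
  thus ?case
  proof cases
    case 1
    thus ?thesis by (rule step.IH)
  next
    case 2
    have "n \<in> insert m (set (desc_block m n))"
    proof (cases "n = m")
      case False
      then obtain k where k: "n = Suc k" "m \<le> k" using step.hyps by (cases n) auto
      thus ?thesis by (simp add: desc_block_Suc)
    qed simp
    thus ?thesis using desc_split[OF 2(2)] 2(1) by (auto simp: adj_def)
  qed
qed simp

section \<open>Splitting words after the last ascending chain\<close>

definition gc_desc :: "nat \<Rightarrow> nat list set" where
  "gc_desc n = desc_ext n (gc_set (n - 1))"

definition gc_asc :: "nat \<Rightarrow> nat list set" where
  "gc_asc n = map (flip n) ` gc_desc n"

lemma gc_desc_1: "gc_desc 1 = {[1]}"
proof -
  have "w = [1]" if "w \<approx> [1]" for w
    using comm_eq_mset[OF that] by (metis mset_single_iff_right mset.simps)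
  thus ?thesis by (auto simp: gc_desc_def desc_ext_def)
qed

lemma gc_asc_1: "gc_asc 1 = {[1]}"
  by (simp add: gc_asc_def gc_desc_1[simplified] flip_def)

lemma gc_set_eq:
  assumes "n \<ge> 1" shows "gc_set n = gc_desc n \<union> gc_asc n"
proof (cases "n = 1")
  case True
  thus ?thesis using gc_desc_1 gc_asc_1 by simp
next
  case False
  then obtain m where "n = Suc (Suc m)" using assms by (cases n rule: gc_set.cases) auto
  thus ?thesis by (simp add: gc_desc_def gc_asc_def)
qed

lemma gc_desc_w0_words: "n \<ge> 1 \<Longrightarrow> gc_desc n \<subseteq> w0_words n"
  using gc_set_eq gc_set_w0_words by blast

lemma gc_asc_w0_words: "n \<ge> 1 \<Longrightarrow> gc_asc n \<subseteq> w0_words n"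
  using gc_set_eq gc_set_w0_words by blast

lemma gc_desc_comm_eq: "w \<approx> w' \<Longrightarrow> w' \<in> gc_desc n \<Longrightarrow> w \<in> gc_desc n"
  by (auto simp: gc_desc_def desc_ext_def intro: comm_eq_trans)

lemma gc_asc_comm_eq:
  assumes "n \<ge> 1" "w \<approx> w'" "w' \<in> gc_asc n" shows "w \<in> gc_asc n"
proof -
  have w': "w' \<in> w0_words n" using assms gc_asc_w0_words by blast
  hence w: "w \<in> w0_words n" using w0_words_comm_eq comm_eq_sym assms(2) by blast
  obtain v where v: "v \<in> gc_desc n" "w' = map (flip n) v" using assms(3) by (auto simp: gc_asc_def)
  hence "map (flip n) w' = v"
    using gc_desc_w0_words[OF assms(1)] map_flip_flip w0_words_letters by (metis subsetD)
  hence "map (flip n) w \<approx> v" using comm_eq_flip[OF assms(2) w0_words_letters[OF w]] by simp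
  hence "map (flip n) w \<in> gc_desc n" using gc_desc_comm_eq v(1) by blast
  thus ?thesis unfolding gc_asc_def using map_flip_flip[OF w0_words_letters[OF w]] by (metis imageI)
qed

lemma gc_asc_form:
  assumes "n \<ge> 1" "w \<in> gc_asc n" shows "\<exists>z. w \<approx> z @ [1..<Suc n]"
proof -
  obtain v where v: "v \<in> gc_desc n" "w = map (flip n) v" using assms(2) by (auto simp: gc_asc_def)
  then obtain u where u: "v \<approx> u @ desc n" by (auto simp: gc_desc_def desc_ext_def)
  have "set v \<subseteq> {1..n}" using v gc_desc_w0_words[OF assms(1)] w0_words_letters by blast
  hence "w \<approx> map (flip n) u @ map (flip n) (desc n)"
    using comm_eq_flip[OF u] v(2) by simp
  also have "map (flip n) (desc n) = [1..<Suc n]"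
  proof -
    have "map (flip n) (map (flip n) [1..<n + 1]) = [1..<n + 1]"
      by (rule map_flip_flip) auto
    thus ?thesis unfolding map_flip_upt by simp
  qed
  finally show ?thesis by blast
qed

text \<open>If the last letter were some \<open>c < m\<close>, the restriction to \<open>c\<close>
  and \<open>c + 1\<close> would end in \<open>c\<close>, whereas \<open>1, ..., m\<close> makes it
  end in \<open>c + 1\<close>.\<close>

lemma last_asc:
  assumes "w \<approx> z @ [1..<Suc m]" "m \<ge> 1" "set w \<subseteq> {1..m}"
  shows "w \<noteq> [] \<and> last w = m"
proof -
  have ne: "w \<noteq> []" using comm_eq_length[OF assms(1)] assms(2) by auto
  moreover have "last w = m"
  proof (rule ccontr)
    assume "last w \<noteq> m"
    moreover define c where "c = last w"
    moreover have "c \<in> {1..m}" using assms(3) ne last_in_set c_def by blast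
    ultimately have c: "1 \<le> c" "Suc c \<le> m" by auto
    have "[1..<Suc m] = [1..<c] @ [c, Suc c] @ [Suc (Suc c)..<Suc m]"
      using c upt_add_eq_append[of 1 c "Suc m - c"]
      by (simp add: upt_conv_Cons)
    moreover have "pair_filter c [Suc (Suc c)..<Suc m] = []"
      by (auto simp: pair_filter_def)
    moreover have "w = butlast w @ [c]" using ne c_def by simp
    hence "pair_filter c w = pair_filter c (butlast w) @ [c]"
      by (metis pair_filter_simps(2,3) pair_filter_simps(1))
    ultimately have "pair_filter c (butlast w) @ [c] =
        pair_filter c z @ pair_filter c [1..<c] @ [c, Suc c]"
      using assms(1) unfolding comm_eq_def by simp
    thus False by (metis append_assoc last_ConsR last_appendR last_snoc last.simps n_not_Suc_n list.distinct(1))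
  qed
  ultimately show ?thesis ..
qed

lemma pair_filter_desc: "pair_filter 1 (desc (Suc (Suc k))) = [2, 1]"
  by (induction k) auto

text \<open>The letters \<open>1\<close> and \<open>2\<close> decide: their restriction ends in
  \<open>2, 1\<close> after a descending and in \<open>1, 2\<close> after an ascending
  chain.\<close>

lemma gc_desc_asc_disjoint:
  assumes "n \<ge> 2" shows "gc_desc n \<inter> gc_asc n = {}"
proof -
  have False if w: "w \<in> gc_desc n" "w \<in> gc_asc n" for w
  proof -
    obtain k where k: "n = Suc (Suc k)" using assms by (metis add_2_eq_Suc le_Suc_ex)
    obtain u where "w \<approx> u @ desc n" using w(1) by (auto simp: gc_desc_def desc_ext_def)
    hence 1: "pair_filter 1 w = pair_filter 1 u @ [2, 1]"
      using pair_filter_desc[of k] k unfolding comm_eq_def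
      by (metis pair_filter_simps(3))
    obtain z where "w \<approx> z @ [1..<Suc n]" using gc_asc_form w(2) assms by force
    moreover have "[1..<Suc n] = [1, 2] @ [3..<Suc n]"
      using k by (simp add: upt_conv_Cons numeral_3_eq_3 numeral_2_eq_2 del: upt_Suc)
    moreover have "pair_filter 1 [3..<Suc n] = []" by (auto simp: pair_filter_def)
    ultimately have "pair_filter 1 w = pair_filter 1 z @ [1, 2]"
      unfolding comm_eq_def by (simp del: upt_Suc)
    with 1 show False by simp
  qed
  thus ?thesis by blast
qed

definition gc_ext :: "nat \<Rightarrow> nat \<Rightarrow> nat list set" where
  "gc_ext m n = {w. \<exists>u\<in>gc_asc m. w \<approx> u @ desc_block m n}"

lemma desc_ext_Un: "desc_ext n (A \<union> B) = desc_ext n A \<union> desc_ext n B"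
  by (auto simp: desc_ext_def)

lemma desc_ext_UN: "desc_ext n (\<Union>i\<in>I. A i) = (\<Union>i\<in>I. desc_ext n (A i))"
  by (auto simp: desc_ext_def)

lemma desc_ext_gc_asc: "desc_ext (Suc n) (gc_asc n) = gc_ext n (Suc n)"
  by (simp add: desc_ext_def gc_ext_def desc_block_Suc)

lemma desc_ext_gc_ext:
  assumes "m \<le> n" shows "desc_ext (Suc n) (gc_ext m n) = gc_ext m (Suc n)"
proof -
  have "(\<exists>v. (\<exists>u\<in>gc_asc m. v \<approx> u @ desc_block m n) \<and> w \<approx> v @ desc (Suc n)) \<longleftrightarrow>
      (\<exists>u\<in>gc_asc m. w \<approx> (u @ desc_block m n) @ desc (Suc n))" for w
    using comm_eq_trans comm_eq_append comm_eq_refl by meson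
  thus ?thesis using assms
    by (auto simp: desc_ext_def gc_ext_def desc_block_Suc simp del: desc_simps)
qed

text \<open>Rank one is counted as ascending, since \<open>gc_asc 1\<close> is all of
  \<open>gc_set 1\<close>; so unfolding the recursion always ends at a last ascending rank
  \<open>m\<close>.\<close>

lemma gc_desc_eq: "n \<ge> 1 \<Longrightarrow> gc_desc (Suc n) = (\<Union>m\<in>{1..n}. gc_ext m (Suc n))"
proof (induction n rule: dec_induct)
  case base
  have "gc_desc (Suc 1) = desc_ext (Suc 1) (gc_asc 1)"
    unfolding gc_asc_1 by (simp add: gc_desc_def)
  also have "\<dots> = gc_ext 1 (Suc 1)" by (rule desc_ext_gc_asc)
  finally show ?case by simp
next
  case (step n)
  have "gc_desc (Suc (Suc n)) = desc_ext (Suc (Suc n)) (gc_desc (Suc n) \<union> gc_asc (Suc n))"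
    using gc_set_eq[of "Suc n"] by (simp add: gc_desc_def[of "Suc (Suc n)"])
  also have "\<dots> = (\<Union>m\<in>{1..n}. gc_ext m (Suc (Suc n))) \<union> gc_ext (Suc n) (Suc (Suc n))"
    unfolding step.IH desc_ext_Un desc_ext_UN desc_ext_gc_asc by (simp add: desc_ext_gc_ext)
  also have "\<dots> = (\<Union>m\<in>{1..Suc n}. gc_ext m (Suc (Suc n)))"
    by (simp add: atLeastAtMostSuc_conv Un_commute)
  finally show ?case .
qed

text \<open>Cancelling the common chains above rank \<open>m\<close> leaves a word of rank
  \<open>m\<close> that would belong to \<open>gc_asc m\<close> and to
  \<open>gc_desc m\<close>.\<close>

lemma gc_ext_disjoint:
  assumes "1 \<le> k" "k < m" "m \<le> n" shows "gc_ext k n \<inter> gc_ext m n = {}"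
proof -
  have False if w: "w \<in> gc_ext k n" "w \<in> gc_ext m n" for w
  proof -
    obtain u v where uv: "u \<in> gc_asc k" "w \<approx> u @ desc_block k n"
      "v \<in> gc_asc m" "w \<approx> v @ desc_block m n"
      using w by (auto simp: gc_ext_def)
    hence "v @ desc_block m n \<approx> (u @ desc_block k m) @ desc_block m n"
      using assms desc_block_split[of k m n] comm_eq_trans comm_eq_sym by (metis append_assoc less_imp_le)
    hence "v \<approx> u @ desc_block k m" by (simp only: comm_eq_append_cancel)
    hence "v \<in> gc_ext k m" using uv(1) by (auto simp: gc_ext_def)
    moreover obtain l where "m = Suc l" "k \<le> l" using assms by (cases m) auto
    ultimately have "v \<in> gc_desc m" using gc_desc_eq[of l] assms(1) by auto
    thus False using gc_desc_asc_disjoint[of m] uv(3) assms by auto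
  qed
  thus ?thesis by blast
qed

text \<open>Concatenation is onto by \<open>comm_eq_splitE\<close>, with the separating letter
  \<open>m\<close> from \<open>last_asc\<close>, and injective because all words of
  \<open>gc_asc m\<close> have the same length.\<close>

lemma card_gc_ext:
  assumes "1 \<le> m" "m \<le> n"
  shows "finite (gc_ext m n) \<and> card (gc_ext m n) = card (gc_asc m) * card (comm_class (desc_block m n))"
proof -
  let ?S = "gc_asc m \<times> comm_class (desc_block m n)"
  have "gc_ext m n = (\<lambda>(u, v). u @ v) ` ?S"
  proof (intro subset_antisym subsetI)
    fix w assume "w \<in> gc_ext m n"
    then obtain u where u: "u \<in> gc_asc m" "w \<approx> u @ desc_block m n" by (auto simp: gc_ext_def)
    have last: "u' \<noteq> [] \<and> last u' = m" if "u' \<approx> u" for u'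
    proof -
      have "u' \<in> gc_asc m" using gc_asc_comm_eq[OF assms(1) that u(1)] .
      thus ?thesis
        using gc_asc_form[OF assms(1)] last_asc assms(1) gc_asc_w0_words[OF assms(1)] w0_words_letters by blast
    qed
    have "\<exists>u' v'. w = u' @ v' \<and> u' \<approx> u \<and> v' \<approx> desc_block m n"
      by (rule comm_eq_splitE[OF u(2), of m])
        (use last desc_block_chained[OF assms(2)] in \<open>simp_all only: simp_thms\<close>)
    then obtain u' v' where "w = u' @ v'" "u' \<approx> u" "v' \<approx> desc_block m n" by blast
    moreover from this(2) have "u' \<in> gc_asc m" using gc_asc_comm_eq[OF assms(1) _ u(1)] by blast
    ultimately show "w \<in> (\<lambda>(u, v). u @ v) ` ?S" by (auto simp: comm_class_def)
  next
    fix w assume "w \<in> (\<lambda>(u, v). u @ v) ` ?S"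
    then obtain u v where "w = u @ v" "u \<in> gc_asc m" "v \<approx> desc_block m n"
      by (auto simp: comm_class_def)
    thus "w \<in> gc_ext m n" using comm_eq_append[OF comm_eq_refl] unfolding gc_ext_def by blast
  qed
  moreover have "inj_on (\<lambda>(u, v). u @ v) ?S"
  proof -
    have key: "u = u' \<and> v = v'" if "u \<in> gc_asc m" "u' \<in> gc_asc m" "u @ v = u' @ v'" for u u' v v'
    proof -
      have "length u = length u'"
        using that(1,2) gc_asc_w0_words[OF assms(1)] w0_words_length by (metis subsetD)
      thus ?thesis using that(3) by simp
    qed
    show ?thesis
    proof (rule inj_onI)
      fix p q
      assume "p \<in> ?S" "q \<in> ?S" "(\<lambda>(u, v). u @ v) p = (\<lambda>(u, v). u @ v) q"
      thus "p = q"
        using key[of "fst p" "fst q" "snd p" "snd q"]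
        by (simp add: prod_eq_iff mem_Times_iff case_prod_beta)
    qed
  qed
  moreover have "finite (gc_asc m)"
  proof (rule finite_subset[OF gc_asc_w0_words[OF assms(1)]])
    have "w0_words m \<subseteq> {w. set w \<subseteq> {1..m} \<and> length w = m * Suc m div 2}"
      unfolding w0_words_def by blast
    thus "finite (w0_words m)" using finite_lists_length_eq[OF finite_atLeastAtMost] finite_subset by blast
  qed
  ultimately show ?thesis
    using finite_comm_class by (simp add: card_image card_cartesian_product)
qed

lemma card_gc_asc: "n \<ge> 1 \<Longrightarrow> card (gc_asc n) = card (gc_desc n)"
  unfolding gc_asc_def
  by (intro card_image inj_on_inverseI[where g = "map (flip n)"] map_flip_flip w0_words_letters)
    (use gc_desc_w0_words in blast)

lemma card_gc_desc:
  assumes "n \<ge> 1"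
  shows "finite (gc_desc (Suc n)) \<and>
    card (gc_desc (Suc n)) = (\<Sum>m=1..n. card (gc_asc m) * card (comm_class (desc_block m (Suc n))))"
proof -
  have "card (\<Union>m\<in>{1..n}. gc_ext m (Suc n)) = (\<Sum>m\<in>{1..n}. card (gc_ext m (Suc n)))"
  proof (rule card_UN_disjoint; (intro ballI impI)?)
    fix i j assume "i \<in> {1..n}" "j \<in> {1..n}" "i \<noteq> j"
    thus "gc_ext i (Suc n) \<inter> gc_ext j (Suc n) = {}"
      using gc_ext_disjoint[of i j "Suc n"] gc_ext_disjoint[of j i "Suc n"]
      by (cases "i < j") auto
  qed (use card_gc_ext in auto)
  thus ?thesis
    using gc_desc_eq[OF assms] card_gc_ext by auto
qed

lemma gc_0: "gc 0 = 1"
  by (simp add: gc_def gc_words_eq)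

lemma gc_1: "gc 1 = 1"
  by (simp add: gc_def gc_words_eq)

lemma gc_eq_double: assumes "n \<ge> 2" shows "gc n = 2 * card (gc_asc n)"
proof -
  obtain m where m: "n = Suc m" "m \<ge> 1" using assms by (cases n) auto
  have "card (gc_desc n \<union> gc_asc n) = card (gc_desc n) + card (gc_asc n)"
    using card_gc_desc[OF m(2)] m gc_desc_asc_disjoint[OF assms]
    by (intro card_Un_disjoint) (auto simp: gc_asc_def)
  thus ?thesis
    using assms gc_set_eq[of n] card_gc_asc[of n] by (simp add: gc_def gc_words_eq)
qed

text \<open>The block starts with the chain \<open>[1]\<close>, the only word of rank one, and by
  \<open>card_gc_ext\<close> this prefix adds no choice. It yields the summand for
  \<open>m = 0\<close> of the recurrence.\<close>

lemma comm_class_desc_block_0: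
  assumes "n \<ge> 1"
  shows "card (comm_class (desc_block 0 n)) = card (comm_class (desc_block 1 n))"
proof -
  have "desc_block 0 n = [1] @ desc_block 1 n"
    using desc_block_split[of 0 1 n] assms desc_block_Suc[of 0 0] by simp
  hence "comm_class (desc_block 0 n) = gc_ext 1 n"
    unfolding gc_ext_def gc_asc_1 comm_class_def by simp
  thus ?thesis using card_gc_ext[of 1 n] assms by (simp add: gc_asc_1[simplified])
qed

lemma gc_recurrence:
  assumes "n \<ge> 2"
  shows "gc n = (\<Sum>m<n. card (comm_class (desc_block m n)) * gc m)"
proof -
  obtain k where k: "n = Suc (Suc k)" using assms by (metis add_2_eq_Suc le_Suc_ex)
  let ?b = "\<lambda>m. card (comm_class (desc_block m n))"
  have "gc n = 2 * (\<Sum>m=1..Suc k. card (gc_asc m) * ?b m)"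
    using gc_eq_double[OF assms] card_gc_asc[of n] card_gc_desc[of "Suc k"] k by simp
  also have "\<dots> = 2 * ?b 1 + (\<Sum>m=2..Suc k. 2 * card (gc_asc m) * ?b m)"
    by (simp add: sum.atLeast_Suc_atMost gc_asc_1[simplified] sum_distrib_left numeral_2_eq_2
        algebra_simps)
  also have "(\<Sum>m=2..Suc k. 2 * card (gc_asc m) * ?b m) = (\<Sum>m=2..Suc k. ?b m * gc m)"
    by (intro sum.cong) (auto simp: gc_eq_double)
  \<comment> \<open>In rank one \<open>gc_asc\<close> is all of \<open>gc_set\<close>, so the factor
    two is left over; its halves become the summands for \<open>m = 0\<close> and
    \<open>m = 1\<close>.\<close>
  also have "2 * ?b 1 + \<dots> = ?b 0 * gc 0 + (?b 1 * gc 1 + \<dots>)"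
    using comm_class_desc_block_0[of n] k gc_0 gc_1 by simp
  also have "\<dots> = (\<Sum>m=0..Suc k. ?b m * gc m)"
    by (simp add: sum.atLeast_Suc_atMost numeral_2_eq_2)
  also have "{0..Suc k} = {..<n}" using k by auto
  finally show ?thesis .
qed

section \<open>Rows of shifted diagrams as words\<close>

text \<open>The cell in row \<open>i\<close> and column \<open>j\<close> of the shifted diagram
  contributes the letter \<open>j - i + 1\<close>; so cells on a diagonal share a letter and
  neighbouring cells have adjacent ones.\<close>

definition rows_word :: "nat list \<Rightarrow> nat list" where
  "rows_word \<mu> = concat (map (\<lambda>r. [1..<Suc r]) \<mu>)"

definition corners :: "nat list \<Rightarrow> nat set" where
  "corners \<mu> = {k. k < length \<mu> \<and> sorted_wrt (>) (\<mu>[k := \<mu> ! k - 1])}"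

text \<open>Removing the corner of a last row of length one leaves a part \<open>0\<close> at the end, which is why
  \<open>\<mu> @ [0]\<close> is admitted.\<close>

definition corner_recursive :: "(nat list \<Rightarrow> 'a::comm_monoid_add) \<Rightarrow> bool" where
  "corner_recursive h \<longleftrightarrow> (\<forall>\<mu>. strict_partition \<mu> \<longrightarrow> h (\<mu> @ [0]) = h \<mu>) \<and>
     (\<forall>\<mu>. strict_partition \<mu> \<longrightarrow> \<mu> \<noteq> [] \<longrightarrow> h \<mu> = (\<Sum>k\<in>corners \<mu>. h (\<mu>[k := \<mu> ! k - 1])))"

lemma strict_partition_nth:
  assumes "strict_partition \<mu>"
  shows "i < j \<Longrightarrow> j < length \<mu> \<Longrightarrow> \<mu> ! j < \<mu> ! i" "i < length \<mu> \<Longrightarrow> 0 < \<mu> ! i"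
  using assms by (auto simp: strict_partition_def sorted_wrt_iff_nth_less)

lemma sum_list_remove:
  assumes "strict_partition \<mu>" "k < length \<mu>"
  shows "sum_list \<mu> = Suc (sum_list (\<mu>[k := \<mu> ! k - 1]))"
proof -
  have "0 < \<mu> ! k" using strict_partition_nth(2)[OF assms] .
  moreover have "\<mu> ! k \<le> sum_list \<mu>" using assms(2) by (simp add: member_le_sum_list)
  ultimately show ?thesis using assms(2) by (simp add: sum_list_update)
qed

text \<open>Removing a corner lowers the sum and dropping a final zero lowers the length, hence the
  measure.\<close>

lemma corner_recursive_unique:
  assumes "corner_recursive h" "corner_recursive h'" "h [] = h' []"
  shows "sorted_wrt (>) \<mu> \<Longrightarrow> h \<mu> = h' \<mu>"
proof (induction \<mu> rule: measure_induct_rule[where f = "\<lambda>\<mu>. sum_list \<mu> + length \<mu>"])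
  case (less \<mu>)
  show ?case
  proof (cases "strict_partition \<mu>")
    case True
    have "h (\<mu>[k := \<mu> ! k - 1]) = h' (\<mu>[k := \<mu> ! k - 1])" if "k \<in> corners \<mu>" for k
      using that sum_list_remove[OF True, of k] by (intro less.IH) (simp_all add: corners_def)
    thus ?thesis using assms True by (cases "\<mu> = []") (auto simp: corner_recursive_def)
  next
    case False
    hence "0 \<in> set \<mu>" using less.prems by (auto simp: strict_partition_def)
    then obtain \<alpha> \<beta> where \<mu>: "\<mu> = \<alpha> @ 0 # \<beta>" by (meson split_list)
    hence "\<beta> = []" using less.prems by (cases \<beta>) (auto simp: sorted_wrt_append)
    hence "strict_partition \<alpha>"
      using less.prems \<mu> by (auto simp: strict_partition_def sorted_wrt_append)
    moreover from this have "h \<alpha> = h' \<alpha>"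
      using \<mu> \<open>\<beta> = []\<close> by (intro less.IH) (auto simp: strict_partition_def)
    ultimately show ?thesis using \<mu> \<open>\<beta> = []\<close> assms by (simp add: corner_recursive_def)
  qed
qed

lemma rows_word_simps [simp]:
  "rows_word [] = []" "rows_word (r # \<mu>) = [1..<Suc r] @ rows_word \<mu>"
  "rows_word (\<mu> @ \<nu>) = rows_word \<mu> @ rows_word \<nu>"
  by (simp_all add: rows_word_def)

lemma set_rows_word: "c \<in> set (rows_word \<mu>) \<longleftrightarrow> 1 \<le> c \<and> (\<exists>r\<in>set \<mu>. c \<le> r)"
  by (induction \<mu>) (auto simp del: upt_Suc)

text \<open>The lowered row is still longer than all later rows, so their letters are at least two
  below the removed letter and commute with it.\<close>

lemma rows_word_corner:
  assumes "strict_partition \<mu>" "k \<in> corners \<mu>"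
  shows "rows_word \<mu> \<approx> rows_word (\<mu>[k := \<mu> ! k - 1]) @ [\<mu> ! k]"
proof -
  define \<alpha> \<beta> c where "\<alpha> = take k \<mu>" and "\<beta> = drop (Suc k) \<mu>" and "c = \<mu> ! k - 1"
  have k: "k < length \<mu>" using assms(2) by (simp add: corners_def)
  have "\<mu> ! k > 0" using assms(1) k by (simp add: strict_partition_def)
  hence \<mu>: "\<mu> = \<alpha> @ Suc c # \<beta>" and \<mu>': "\<mu>[k := \<mu> ! k - 1] = \<alpha> @ c # \<beta>" and c: "\<mu> ! k = Suc c"
    using k by (simp_all add: \<alpha>_def \<beta>_def c_def id_take_nth_drop upd_conv_take_nth_drop)
  have "sorted_wrt (>) (\<alpha> @ c # \<beta>)" using assms(2) \<mu>' by (simp add: corners_def)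
  hence "\<forall>r\<in>set \<beta>. r < c" by (simp add: sorted_wrt_append)
  hence "Suc c # rows_word \<beta> \<approx> rows_word \<beta> @ [Suc c]"
    by (intro comm_eq_move) (fastforce simp: set_rows_word adj_def)
  hence "(rows_word \<alpha> @ [1..<Suc c]) @ Suc c # rows_word \<beta> \<approx>
      (rows_word \<alpha> @ [1..<Suc c]) @ rows_word \<beta> @ [Suc c]"
    by (intro comm_eq_append comm_eq_refl)
  moreover have "rows_word \<mu> = (rows_word \<alpha> @ [1..<Suc c]) @ Suc c # rows_word \<beta>"
    by (subst \<mu>) (simp add: upt_Suc_append)
  ultimately show ?thesis unfolding \<mu>' unfolding c by (simp del: upt_Suc)
qed

text \<open>Take the last row that contains \<open>c\<close>. Whatever follows this \<open>c\<close>
  avoids \<open>c - 1\<close>, \<open>c\<close> and \<open>c + 1\<close>; thus the row ends at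
  \<open>c\<close>, and later rows are shorter than \<open>c - 1\<close>.\<close>

lemma rows_word_snocE:
  assumes "strict_partition \<mu>" "w @ [c] \<approx> rows_word \<mu>"
  shows "\<exists>k\<in>corners \<mu>. c = \<mu> ! k"
proof -
  obtain x y where xy: "rows_word \<mu> = x @ c # y" "\<And>z. z \<in> set y \<Longrightarrow> z \<noteq> c \<and> \<not> adj c z"
    using assms(2) by (rule comm_eq_snocE) blast
  have "c \<in> set (rows_word \<mu>)" using xy by simp
  hence c: "1 \<le> c" and "\<exists>r\<in>set \<mu>. c \<le> r" by (auto simp: set_rows_word)
  then obtain \<alpha> r \<beta> where \<mu>: "\<mu> = \<alpha> @ r # \<beta>" "c \<le> r" "\<And>b. b \<in> set \<beta> \<Longrightarrow> b < c"
    using split_list_last_prop[of \<mu> "\<lambda>r. c \<le> r"] by (metis not_le)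
  have "[1..<Suc r] = [1..<c] @ c # [Suc c..<Suc r]"
    using c \<mu>(2) upt_add_eq_append[of 1 c "Suc r - c"] by (simp add: upt_conv_Cons)
  hence "rows_word \<mu> = (rows_word \<alpha> @ [1..<c]) @ c # ([Suc c..<Suc r] @ rows_word \<beta>)"
    using \<mu>(1) by simp
  moreover have "c \<notin> set ([Suc c..<Suc r] @ rows_word \<beta>)"
    using \<mu>(3) by (fastforce simp: set_rows_word)
  moreover have "c \<notin> set y" using xy(2) by blast
  moreover have y_eq: "y = y'" if "x @ c # y = x' @ c # y'" "c \<notin> set y" "c \<notin> set y'" for x' y'
    using that by (auto simp: append_eq_append_conv2 Cons_eq_append_conv append_eq_Cons_conv)
  ultimately have y: "y = [Suc c..<Suc r] @ rows_word \<beta>"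
    using xy(1) by (intro y_eq) simp_all
  have "r = c"
  proof (rule ccontr)
    assume "r \<noteq> c"
    hence "Suc c \<in> set y" using \<mu>(2) y by (simp del: upt_Suc)
    thus False using xy(2)[of "Suc c"] by (simp add: adj_def)
  qed
  have "b < c - 1" if b: "b \<in> set \<beta>" for b
  proof (rule ccontr)
    assume "\<not> b < c - 1"
    moreover have "b > 0" using assms(1) \<mu>(1) b by (simp add: strict_partition_def)
    ultimately have "1 \<le> c - 1" "c - 1 \<le> b" using \<mu>(3)[OF b] by auto
    hence "c - 1 \<in> set y" unfolding y using b by (auto simp: set_rows_word)
    thus False using xy(2)[of "c - 1"] c by (auto simp: adj_def)
  qed
  moreover have "sorted_wrt (>) (\<alpha> @ c # \<beta>)"
    using assms(1) \<mu>(1) \<open>r = c\<close> by (simp add: strict_partition_def)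
  ultimately have "sorted_wrt (>) (\<alpha> @ (c - 1) # \<beta>)"
    by (fastforce simp: sorted_wrt_append)
  hence "length \<alpha> \<in> corners \<mu>" "\<mu> ! length \<alpha> = c"
    using \<mu>(1) \<open>r = c\<close> by (auto simp: corners_def)
  thus ?thesis by auto
qed

text \<open>Words are classified by their last letter. These letters are the parts at the corners,
  and distinct parts make the classes disjoint.\<close>

lemma corner_recursive_comm_class: "corner_recursive (\<lambda>\<mu>. card (comm_class (rows_word \<mu>)))"
  unfolding corner_recursive_def
proof (intro conjI allI impI)
  fix \<mu> assume \<mu>: "strict_partition \<mu>" "\<mu> \<noteq> []"
  let ?C = "\<lambda>k. comm_class (rows_word (\<mu>[k := \<mu> ! k - 1]))"
  let ?D = "\<lambda>k. (\<lambda>w. w @ [\<mu> ! k]) ` ?C k"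
  have "comm_class (rows_word \<mu>) = (\<Union>k\<in>corners \<mu>. ?D k)"
  proof (intro subset_antisym subsetI)
    fix w assume w: "w \<in> comm_class (rows_word \<mu>)"
    have "rows_word \<mu> \<noteq> []" using \<mu> by (cases \<mu>) (auto simp: strict_partition_def)
    hence "w \<noteq> []" using w comm_eq_length by (fastforce simp: comm_class_def)
    then obtain v c where v: "w = v @ [c]" by (metis rev_exhaust)
    hence vc: "v @ [c] \<approx> rows_word \<mu>" using w by (simp add: comm_class_def)
    then obtain k where k: "k \<in> corners \<mu>" "c = \<mu> ! k" using rows_word_snocE[OF \<mu>(1)] by blast
    have "v @ [c] \<approx> rows_word (\<mu>[k := \<mu> ! k - 1]) @ [c]"
      using vc rows_word_corner[OF \<mu>(1) k(1)] k(2) comm_eq_trans by blast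
    hence "v \<approx> rows_word (\<mu>[k := \<mu> ! k - 1])" by (simp only: comm_eq_append_cancel)
    thus "w \<in> (\<Union>k\<in>corners \<mu>. ?D k)" using k v by (auto simp: comm_class_def)
  next
    fix w assume "w \<in> (\<Union>k\<in>corners \<mu>. ?D k)"
    then obtain k v where k: "k \<in> corners \<mu>" "w = v @ [\<mu> ! k]" "v \<approx> rows_word (\<mu>[k := \<mu> ! k - 1])"
      by (auto simp: comm_class_def)
    have "v @ [\<mu> ! k] \<approx> rows_word (\<mu>[k := \<mu> ! k - 1]) @ [\<mu> ! k]"
      using k(3) by (simp only: comm_eq_append_cancel)
    thus "w \<in> comm_class (rows_word \<mu>)"
      using comm_eq_trans comm_eq_sym[OF rows_word_corner[OF \<mu>(1) k(1)]] k(2)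
      by (auto simp: comm_class_def)
  qed
  also have "card \<dots> = (\<Sum>k\<in>corners \<mu>. card (?D k))"
  proof (rule card_UN_disjoint; (intro ballI impI)?)
    show "finite (corners \<mu>)" by (simp add: corners_def)
    show "finite (?D k)" for k using finite_comm_class by blast
    fix i j assume ij: "i \<in> corners \<mu>" "j \<in> corners \<mu>" "i \<noteq> j"
    have "\<mu> ! i \<noteq> \<mu> ! j"
      using ij \<mu>(1) unfolding corners_def strict_partition_def
      by (metis (mono_tags, lifting) linorder_neqE_nat mem_Collect_eq nat_neq_iff sorted_wrt_iff_nth_less)
    thus "?D i \<inter> ?D j = {}" by auto
  qed
  also have "\<dots> = (\<Sum>k\<in>corners \<mu>. card (?C k))"
    by (intro sum.cong card_image) (auto simp: inj_on_def)
  finally show "card (comm_class (rows_word \<mu>)) = (\<Sum>k\<in>corners \<mu>. card (?C k))" .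
qed simp

lemma card_comm_class_rev: "card (comm_class (rev v)) = card (comm_class v)"
proof -
  have "comm_class (rev v) = rev ` comm_class v"
  proof (intro subset_antisym subsetI)
    fix w assume "w \<in> comm_class (rev v)"
    hence "rev w \<in> comm_class v" using comm_eq_rev[of "rev w" v] by (simp add: comm_class_def comm_eq_rev[of w "rev v", symmetric])
    thus "w \<in> rev ` comm_class v" by (metis imageI rev_rev_ident)
  qed (auto simp: comm_class_def comm_eq_rev)
  thus ?thesis by (simp add: card_image)
qed

lemma rev_desc_block: "rev (desc_block m n) = rows_word (rev [Suc m..<Suc n])"
  by (simp add: desc_block_def rows_word_def rev_concat rev_map desc_def comp_def)

section \<open>The product formula\<close>

text \<open>Vieta for the two leading coefficients: in \<open>lagrange_sum\<close> the first makes
  \<open>p - q\<close> drop in degree, and the second is the one compared.\<close>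

lemma coeff_prod_linear:
  fixes b :: "'i \<Rightarrow> 'a::field"
  assumes "finite A"
  shows "degree (\<Prod>j\<in>A. [:- b j, 1:]) = card A \<and> coeff (\<Prod>j\<in>A. [:- b j, 1:]) (card A) = 1 \<and>
    (A \<noteq> {} \<longrightarrow> coeff (\<Prod>j\<in>A. [:- b j, 1:]) (card A - 1) = - (\<Sum>j\<in>A. b j))"
  using assms
proof (induction rule: finite_induct)
  case (insert x A)
  let ?P = "\<Prod>j\<in>A. [:- b j, 1:]"
  have deg: "degree ?P = card A" and lead: "coeff ?P (card A) = 1" using insert.IH by auto
  have prod: "(\<Prod>j\<in>insert x A. [:- b j, 1:]) = smult (- b x) ?P + pCons 0 ?P"
    using insert.hyps by simp
  have "coeff (\<Prod>j\<in>insert x A. [:- b j, 1:]) (card A) = - (\<Sum>j\<in>insert x A. b j)"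
  proof (cases "A = {}")
    case False
    then obtain m where "card A = Suc m" using insert.hyps by (metis card_eq_0_iff not0_implies_Suc)
    thus ?thesis using insert False lead unfolding prod by simp
  qed simp
  moreover have top: "coeff (\<Prod>j\<in>insert x A. [:- b j, 1:]) (Suc (card A)) = 1"
    using lead deg coeff_eq_0[of ?P "Suc (card A)"] unfolding prod by simp
  moreover have "degree (\<Prod>j\<in>insert x A. [:- b j, 1:]) = Suc (card A)"
  proof (rule antisym)
    show "degree (\<Prod>j\<in>insert x A. [:- b j, 1:]) \<le> Suc (card A)"
      unfolding prod using deg
      by (intro degree_add_le order.trans[OF degree_smult_le] order.trans[OF degree_pCons_le]) auto
    show "Suc (card A) \<le> degree (\<Prod>j\<in>insert x A. [:- b j, 1:])"
      using top by (intro le_degree) simp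
  qed
  ultimately show ?case using insert.hyps by simp
qed simp

text \<open>Both sides are the coefficient of \<open>u\<^bsup>t-1\<^esup>\<close> in \<open>\<Prod>(u - b\<^sub>j) - \<Prod>(u - a\<^sub>j)\<close>, where \<open>t\<close> is
  the size of \<open>A\<close>; the left one is read off from Lagrange interpolation at the points \<open>a\<^sub>i\<close>.\<close>

lemma lagrange_sum:
  fixes a b :: "'i \<Rightarrow> 'a::field"
  assumes fin: "finite A" and inj: "inj_on a A"
  shows "(\<Sum>i\<in>A. (\<Prod>j\<in>A. a i - b j) / (\<Prod>j\<in>A - {i}. a i - a j)) = (\<Sum>j\<in>A. a j - b j)"
proof (cases "A = {}")
  case False
  define p where "p = (\<Prod>j\<in>A. [:- b j, 1:])"
  define q where "q = (\<Prod>j\<in>A. [:- a j, 1:])"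
  define c where "c i = (\<Prod>j\<in>A. a i - b j) / (\<Prod>j\<in>A - {i}. a i - a j)" for i
  define L where "L = (\<Sum>i\<in>A. smult (c i) (\<Prod>j\<in>A - {i}. [:- a j, 1:]))"
  have card: "card A > 0" using False fin by (simp add: card_gt_0_iff)
  have deg_pq: "degree (p - q) < card A"
  proof (rule degree_lessI)
    show "\<forall>k\<ge>card A. coeff (p - q) k = 0"
      using coeff_prod_linear[OF fin, of a] coeff_prod_linear[OF fin, of b]
      by (auto simp: p_def q_def le_less coeff_eq_0)
  qed (use card in simp)
  have deg_L: "degree L < card A"
    unfolding L_def using fin card
    by (intro degree_sum_less[OF _ card] le_less_trans[OF degree_smult_le])
      (simp add: coeff_prod_linear)
  \<comment> \<open>Both sides have degree below \<open>card A\<close> and agree at the distinct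
    points \<open>a i\<close>, where \<open>q\<close> vanishes.\<close>
  have "p - q = L"
  proof (rule poly_eqI_degree[of "a ` A"])
    fix x assume "x \<in> a ` A"
    then obtain i where i: "i \<in> A" "x = a i" by blast
    have "poly q x = 0" using i fin by (auto simp: q_def poly_prod)
    moreover have "poly L x = c i * (\<Prod>j\<in>A - {i}. a i - a j)"
    proof -
      have "poly L x = (\<Sum>k\<in>A. c k * (\<Prod>j\<in>A - {k}. a i - a j))"
        by (simp add: L_def poly_sum poly_prod i(2))
      also have "\<dots> = (\<Sum>k\<in>{i}. c k * (\<Prod>j\<in>A - {k}. a i - a j))"
        using i fin by (intro sum.mono_neutral_right) auto
      finally show ?thesis by simp
    qed
    moreover have "(\<Prod>j\<in>A - {i}. a i - a j) \<noteq> 0"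
      using i inj fin by (auto simp: inj_on_def)
    ultimately show "poly (p - q) x = poly L x"
      by (simp add: p_def poly_prod c_def i(2))
  qed (use deg_pq deg_L in \<open>simp_all add: card_image[OF inj]\<close>)
  moreover have "coeff (p - q) (card A - 1) = (\<Sum>j\<in>A. a j) - (\<Sum>j\<in>A. b j)"
    using coeff_prod_linear[OF fin, of a] coeff_prod_linear[OF fin, of b] False
    by (simp add: p_def q_def)
  moreover have "coeff L (card A - 1) = (\<Sum>i\<in>A. c i)"
  proof -
    have "coeff (\<Prod>j\<in>A - {i}. [:- a j, 1:]) (card A - 1) = 1" if "i \<in> A" for i
      using coeff_prod_linear[of "A - {i}" a] fin that by simp
    thus ?thesis by (simp add: L_def coeff_sum)
  qed
  ultimately show ?thesis by (simp add: c_def sum_subtractf)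
qed simp

text \<open>In \<open>lagrange_sum\<close> take \<open>a i = x i * (x i - 1)\<close> and
  \<open>b i = x i * (x i + 1)\<close>. Then \<open>a i - b i = - 2 * x i\<close>, and the factor
  \<open>- 2\<close> cancels. The last hypothesis, with injectivity of \<open>x\<close>, keeps the
  nodes distinct.\<close>

lemma shifted_sum_identity:
  fixes x :: "'i \<Rightarrow> real"
  assumes fin: "finite A" and inj: "inj_on x A"
    and ne: "\<And>i j. i \<in> A \<Longrightarrow> j \<in> A \<Longrightarrow> i \<noteq> j \<Longrightarrow> x i + x j \<noteq> 1"
  shows "(\<Sum>i\<in>A. x i * (\<Prod>j\<in>A - {i}. (x i - 1 - x j) * (x i + x j) / ((x i - 1 + x j) * (x i - x j)))) =
    (\<Sum>j\<in>A. x j)"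
proof -
  \<comment> \<open>\<open>(z - 1 - x\<^sub>j) (z + x\<^sub>j) / ((z - 1 + x\<^sub>j) (z - x\<^sub>j))\<close> depends only on \<open>z (z - 1)\<close>.\<close>
  define a where "a i = x i * (x i - 1)" for i
  define b where "b i = x i * (x i + 1)" for i
  have ab: "(x i - 1 - x j) * (x i + x j) = a i - b j" "(x i - 1 + x j) * (x i - x j) = a i - a j" for i j
    by (simp_all add: a_def b_def algebra_simps)
  have "inj_on a A"
  proof (rule inj_onI, rule ccontr)
    fix i j assume ij: "i \<in> A" "j \<in> A" "a i = a j" "i \<noteq> j"
    hence "(x i - 1 + x j) * (x i - x j) = 0" using ab(2)[of i j] by simp
    thus False using ij ne[of i j] inj by (auto simp: inj_on_def)
  qed
  from lagrange_sum[OF fin this, of b]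
  have "(\<Sum>i\<in>A. (\<Prod>j\<in>A. a i - b j) / (\<Prod>j\<in>A - {i}. a i - a j)) = (\<Sum>j\<in>A. - 2 * x j)"
    by (simp add: a_def b_def algebra_simps)
  also have "(\<Sum>i\<in>A. (\<Prod>j\<in>A. a i - b j) / (\<Prod>j\<in>A - {i}. a i - a j)) =
      (\<Sum>i\<in>A. - 2 * (x i * (\<Prod>j\<in>A - {i}. (a i - b j) / (a i - a j))))"
  proof (rule sum.cong[OF refl])
    fix i assume "i \<in> A"
    hence "(\<Prod>j\<in>A. a i - b j) = (a i - b i) * (\<Prod>j\<in>A - {i}. a i - b j)"
      using fin by (simp add: prod.remove)
    thus "(\<Prod>j\<in>A. a i - b j) / (\<Prod>j\<in>A - {i}. a i - a j) =
        - 2 * (x i * (\<Prod>j\<in>A - {i}. (a i - b j) / (a i - a j)))"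
      by (simp add: prod_dividef a_def b_def algebra_simps)
  qed
  finally show ?thesis unfolding ab sum_distrib_left[symmetric] by simp
qed

section \<open>Corner recursion for the product formula\<close>

definition shifted_count :: "nat list \<Rightarrow> real" where
  "shifted_count \<mu> = fact (sum_list \<mu>) / (\<Prod>i<length \<mu>. fact (\<mu> ! i)) *
     (\<Prod>(i, j) \<in> {(i, j). i < j \<and> j < length \<mu>}.
        (real (\<mu> ! i) - real (\<mu> ! j)) / (real (\<mu> ! i) + real (\<mu> ! j)))"

lemma finite_pairs: "finite {(i, j). i < j \<and> j < (n::nat)}"
  by (rule finite_subset[of _ "{..<n} \<times> {..<n}"]) auto

lemma shifted_count_snoc_0:
  assumes "strict_partition \<mu>" shows "shifted_count (\<mu> @ [0]) = shifted_count \<mu>"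
proof -
  let ?n = "length \<mu>"
  let ?f = "\<lambda>\<mu> (i, j). (real (\<mu> ! i) - real (\<mu> ! j)) / (real (\<mu> ! i) + real (\<mu> ! j))"
  have "{(i, j). i < j \<and> j < Suc ?n} = {(i, j). i < j \<and> j < ?n} \<union> (\<lambda>i. (i, ?n)) ` {..<?n}"
    by (auto simp: less_Suc_eq)
  hence "prod (?f (\<mu> @ [0])) {(i, j). i < j \<and> j < Suc ?n} =
      prod (?f (\<mu> @ [0])) {(i, j). i < j \<and> j < ?n} * prod (?f (\<mu> @ [0])) ((\<lambda>i. (i, ?n)) ` {..<?n})"
    using finite_pairs by (simp only:) (rule prod.union_disjoint; auto)
  also have "prod (?f (\<mu> @ [0])) ((\<lambda>i. (i, ?n)) ` {..<?n}) = 1"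
    using assms by (intro prod.neutral) (auto simp: nth_append strict_partition_def)
  also have "prod (?f (\<mu> @ [0])) {(i, j). i < j \<and> j < ?n} = prod (?f \<mu>) {(i, j). i < j \<and> j < ?n}"
    by (intro prod.cong) (auto simp: nth_append)
  finally show ?thesis by (simp add: shifted_count_def nth_append)
qed

lemma corners_iff:
  assumes "strict_partition \<mu>" "k < length \<mu>"
  shows "k \<in> corners \<mu> \<longleftrightarrow> (Suc k < length \<mu> \<longrightarrow> \<mu> ! Suc k < \<mu> ! k - 1)"
proof
  assume "k \<in> corners \<mu>"
  hence "sorted_wrt (>) (\<mu>[k := \<mu> ! k - 1])" by (simp add: corners_def)
  thus "Suc k < length \<mu> \<longrightarrow> \<mu> ! Suc k < \<mu> ! k - 1"
    using sorted_wrt_nth_less[of "(>)" "\<mu>[k := \<mu> ! k - 1]" k "Suc k"] by simp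
next
  assume c: "Suc k < length \<mu> \<longrightarrow> \<mu> ! Suc k < \<mu> ! k - 1"
  have "\<mu>[k := \<mu> ! k - 1] ! j < \<mu>[k := \<mu> ! k - 1] ! i" if "i < j" "j < length \<mu>" for i j
  proof -
    note lt = strict_partition_nth(1)[OF assms(1)]
    consider "i = k" "j = Suc k" | "i = k" "Suc k < j" | "j = k" | "i \<noteq> k" "j \<noteq> k"
      using \<open>i < j\<close> by linarith
    thus ?thesis
    proof cases
      case 2
      hence "\<mu> ! j < \<mu> ! Suc k" using lt that by blast
      thus ?thesis using c 2 that by simp
    next
      case 3
      thus ?thesis using lt[OF that] that by simp
    qed (use c that lt in auto)
  qed
  thus "k \<in> corners \<mu>" using assms(2) by (simp add: corners_def sorted_wrt_iff_nth_less)
qed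

lemma prod_pairs_at:
  fixes g :: "nat \<Rightarrow> 'a::comm_monoid_mult"
  assumes k: "k < n"
  shows "(\<Prod>(i, j)\<in>{(i, j). i < j \<and> j < n}. if i = k then g j else if j = k then g i else 1) =
    (\<Prod>j\<in>{..<n} - {k}. g j)"
proof -
  let ?h = "\<lambda>(i, j). if i = k then g j else if j = k then g i else 1"
  let ?P = "{(i, j). i < j \<and> j < n \<and> (i = k \<or> j = k)}"
  have "prod ?h {(i, j). i < j \<and> j < n} = prod ?h ?P"
    by (intro prod.mono_neutral_right finite_pairs) (auto split: if_splits)
  also have "\<dots> = (\<Prod>j\<in>{..<n} - {k}. g j)"
  proof (rule prod.reindex_bij_witness[of _ "\<lambda>j. (min j k, max j k)" "\<lambda>(i, j). if i = k then j else i"])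
  qed (use k in \<open>auto simp: min_def max_def split: if_splits\<close>)
  finally show ?thesis .
qed

lemma factor_ratio:
  fixes a b :: real
  assumes "a \<noteq> b" "a + b > 1"
  shows "(a - 1 - b) / (a - 1 + b) =
    (a - b) / (a + b) * ((a - 1 - b) * (a + b) / ((a - 1 + b) * (a - b)))"
  using assms by simp

text \<open>When the lowered part is the second of the pair, both quotients change sign, so the
  correction factor is the same as in \<open>factor_ratio\<close>.\<close>

lemma factor_ratio':
  fixes a b :: real
  assumes "a \<noteq> b" "a + b > 1"
  shows "(b - (a - 1)) / (b + (a - 1)) =
    (b - a) / (b + a) * ((a - 1 - b) * (a + b) / ((a - 1 + b) * (a - b)))"
proof -
  have "(b - (a - 1)) / (b + (a - 1)) = - ((a - 1 - b) / (a - 1 + b))"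
    by (simp only: minus_divide_left minus_diff_eq add.commute)
  also have "\<dots> = - ((a - b) / (a + b)) * ((a - 1 - b) * (a + b) / ((a - 1 + b) * (a - b)))"
    unfolding factor_ratio[OF assms] by simp
  also have "- ((a - b) / (a + b)) = (b - a) / (b + a)"
    by (simp only: minus_divide_left minus_diff_eq add.commute)
  finally show ?thesis .
qed

text \<open>Lowering part \<open>k\<close> divides the factorial of the size by the size, cancels
  one factor \<open>\<mu> ! k\<close> of the denominator, and changes only the quotients of pairs
  containing \<open>k\<close>. It covers every row, corner or not, as the interpolation identity
  sums over all rows.\<close>

lemma shifted_count_remove:
  assumes \<mu>: "strict_partition \<mu>" and k: "k < length \<mu>"
  shows "shifted_count (\<mu>[k := \<mu> ! k - 1]) = shifted_count \<mu> / real (sum_list \<mu>) *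
    (real (\<mu> ! k) * (\<Prod>j\<in>{..<length \<mu>} - {k}.
      (real (\<mu> ! k) - 1 - real (\<mu> ! j)) * (real (\<mu> ! k) + real (\<mu> ! j)) /
      ((real (\<mu> ! k) - 1 + real (\<mu> ! j)) * (real (\<mu> ! k) - real (\<mu> ! j)))))"
proof -
  let ?n = "length \<mu>" and ?\<mu> = "\<mu>[k := \<mu> ! k - 1]"
  define x where "x i = real (\<mu> ! i)" for i
  define \<rho> where "\<rho> j = (x k - 1 - x j) * (x k + x j) / ((x k - 1 + x j) * (x k - x j))" for j
  define P where "P = {(i, j). i < j \<and> j < ?n}"
  define f where "f y = (\<lambda>(i, j). (y i - y j) / (y i + y j))" for y :: "nat \<Rightarrow> real"
  define x' where "x' i = (if i = k then x k - 1 else x i)" for i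
  have pos: "\<mu> ! k > 0" using strict_partition_nth(2)[OF \<mu> k] .
  have x': "real (?\<mu> ! i) = x' i" if "i < ?n" for i
    using that pos k by (auto simp: x'_def x_def nth_list_update)
  have x: "x i \<ge> 1" if "i < ?n" for i using strict_partition_nth(2)[OF \<mu> that] by (simp add: x_def)
  have dist: "x i \<noteq> x j \<and> x i + x j > 1" if "i < ?n" "j < ?n" "i \<noteq> j" for i j
    using x[of i] x[of j] strict_partition_nth(1)[OF \<mu>, of i j] strict_partition_nth(1)[OF \<mu>, of j i] that
    by (cases "i < j") (auto simp: x_def)
  have step: "f x' (i, j) = f x (i, j) * (if i = k then \<rho> j else if j = k then \<rho> i else 1)"
    if ij: "(i, j) \<in> P" for i j
  proof -
    have "i < ?n" "j < ?n" "i \<noteq> j" using ij by (auto simp: P_def)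
    note d = dist[OF this]
    consider "i = k" | "j = k" | "i \<noteq> k" "j \<noteq> k" by blast
    thus ?thesis
    proof cases
      case 1
      thus ?thesis using factor_ratio[of "x k" "x j"] d \<open>i \<noteq> j\<close> by (simp add: f_def \<rho>_def x'_def)
    next
      case 2
      thus ?thesis using factor_ratio'[of "x k" "x i"] d \<open>i \<noteq> j\<close>
        by (simp add: f_def \<rho>_def x'_def add.commute)
    qed (simp add: f_def x'_def)
  qed
  have "prod (f x') P = prod (\<lambda>(i, j). f x (i, j) * (if i = k then \<rho> j else if j = k then \<rho> i else 1)) P"
    using step by (intro prod.cong) auto
  also have "\<dots> = prod (f x) P * (\<Prod>j\<in>{..<?n} - {k}. \<rho> j)"
    unfolding prod_pairs_at[OF k, of \<rho>, symmetric] P_def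
    by (simp add: prod.distrib[symmetric] case_prod_unfold)
  finally have pairs: "prod (f x') P = prod (f x) P * (\<Prod>j\<in>{..<?n} - {k}. \<rho> j)" .
  have facts: "(\<Prod>i<?n. fact (\<mu> ! i)) = x k * (\<Prod>i<?n. fact (?\<mu> ! i) :: real)"
  proof -
    have "(\<Prod>i<?n. fact (\<mu> ! i) :: real) = fact (\<mu> ! k) * (\<Prod>i\<in>{..<?n} - {k}. fact (\<mu> ! i))"
      using k by (intro prod.remove) auto
    also have "fact (\<mu> ! k) = x k * (fact (?\<mu> ! k) :: real)"
      using pos k fact_reduce[of "\<mu> ! k", where 'a = real] by (simp add: x_def)
    also have "(\<Prod>i\<in>{..<?n} - {k}. fact (\<mu> ! i) :: real) = (\<Prod>i\<in>{..<?n} - {k}. fact (?\<mu> ! i))"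
      by (intro prod.cong) auto
    also have "x k * fact (?\<mu> ! k) * \<dots> = x k * (\<Prod>i<?n. fact (?\<mu> ! i))"
      using k by (simp add: prod.remove[of "{..<?n}" k])
    finally show ?thesis .
  qed
  note sum = sum_list_remove[OF \<mu> k]
  have "shifted_count ?\<mu> =
      fact (sum_list ?\<mu>) / (\<Prod>i<?n. fact (?\<mu> ! i)) * prod (f x') P"
    unfolding shifted_count_def P_def f_def
    by (auto intro!: arg_cong2[of _ _ _ _ "(*)"] prod.cong simp: x'[simplified])
  note new = this[unfolded pairs]
  have "fact (sum_list \<mu>) = real (sum_list \<mu>) * fact (sum_list ?\<mu>)"
    unfolding sum by (rule fact_Suc)
  hence old: "shifted_count \<mu> =
      (real (sum_list \<mu>) * fact (sum_list ?\<mu>)) / (x k * (\<Prod>i<?n. fact (?\<mu> ! i))) * prod (f x) P"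
    unfolding shifted_count_def P_def f_def facts by (simp only: x_def)
  have alg: "a / g * (q * r) = (n * a) / (y * g) * q / n * (y * r)"
    if "y \<noteq> 0" "n \<noteq> 0" for a g q r n y :: real
    using that by (cases "g = 0") (simp_all add: field_simps)
  have "x k \<noteq> 0" using x[OF k] by linarith
  moreover have "real (sum_list \<mu>) \<noteq> 0" using sum by simp
  ultimately have "shifted_count ?\<mu> =
      shifted_count \<mu> / real (sum_list \<mu>) * (x k * (\<Prod>j\<in>{..<?n} - {k}. \<rho> j))"
    unfolding new old by (rule alg)
  thus ?thesis by (simp only: \<rho>_def x_def)
qed

text \<open>The identity gives a sum over all rows. A row that is no corner has
  \<open>\<mu> ! k - 1 = \<mu> ! Suc k\<close>, so after lowering it a difference in the product
  vanishes.\<close>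

lemma corner_recursive_shifted_count: "corner_recursive shifted_count"
  unfolding corner_recursive_def
proof (intro conjI allI impI shifted_count_snoc_0)
  fix \<mu> assume \<mu>: "strict_partition \<mu>" "\<mu> \<noteq> []"
  let ?n = "length \<mu>"
  define x where "x i = real (\<mu> ! i)" for i
  have x: "x i \<ge> 1" if "i < ?n" for i using strict_partition_nth(2)[OF \<mu>(1) that] by (simp add: x_def)
  have "inj_on x {..<?n}"
  proof (rule linorder_inj_onI')
    fix i j assume "i \<in> {..<?n}" "j \<in> {..<?n}" "i < j"
    thus "x i \<noteq> x j" using strict_partition_nth(1)[OF \<mu>(1), of i j] by (simp add: x_def)
  qed
  hence id: "(\<Sum>k<?n. x k * (\<Prod>j\<in>{..<?n} - {k}. (x k - 1 - x j) * (x k + x j) /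
      ((x k - 1 + x j) * (x k - x j)))) = (\<Sum>k<?n. x k)"
  proof (intro shifted_sum_identity)
    fix i j assume "i \<in> {..<?n}" "j \<in> {..<?n}"
    thus "x i + x j \<noteq> 1" using x[of i] x[of j] by simp
  qed simp_all
  have N: "(\<Sum>k<?n. x k) = real (sum_list \<mu>)"
    by (simp add: x_def sum_list_sum_nth atLeast0LessThan)
  have "sum_list \<mu> > 0" using \<mu> by (cases \<mu>) (auto simp: strict_partition_def)
  hence "(\<Sum>k<?n. x k) \<noteq> 0" unfolding N by linarith
  hence "shifted_count \<mu> = shifted_count \<mu> / real (sum_list \<mu>) * (\<Sum>k<?n. x k)"
    unfolding N[symmetric] by simp
  also have "\<dots> = (\<Sum>k<?n. shifted_count (\<mu>[k := \<mu> ! k - 1]))"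
    unfolding id[symmetric] sum_distrib_left
    using shifted_count_remove[OF \<mu>(1)] unfolding x_def by (intro sum.cong) auto
  also have "\<dots> = (\<Sum>k\<in>corners \<mu>. shifted_count (\<mu>[k := \<mu> ! k - 1]))"
  proof (rule sum.mono_neutral_right)
    show "\<forall>k\<in>{..<?n} - corners \<mu>. shifted_count (\<mu>[k := \<mu> ! k - 1]) = 0"
    proof
      fix k assume k: "k \<in> {..<?n} - corners \<mu>"
      hence l: "Suc k < ?n" "\<not> \<mu> ! Suc k < \<mu> ! k - 1" using corners_iff[OF \<mu>(1), of k] by auto
      moreover have "\<mu> ! Suc k < \<mu> ! k" using strict_partition_nth(1)[OF \<mu>(1)] l(1) by simp
      ultimately have "\<mu> ! Suc k = \<mu> ! k - 1" by linarith
      thus "shifted_count (\<mu>[k := \<mu> ! k - 1]) = 0"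
        unfolding shifted_count_def mult_eq_0_iff length_list_update
        by (intro disjI2 prod_zero[OF finite_pairs] bexI[of _ "(k, Suc k)"]) (use l(1) in auto)
    qed
  qed (auto simp: corners_def)
  finally show "shifted_count \<mu> = (\<Sum>k\<in>corners \<mu>. shifted_count (\<mu>[k := \<mu> ! k - 1]))" .
qed

section \<open>Standard Young tableaux of shifted shape\<close>

lemma shifted_diagram_snoc_0: "shifted_diagram (\<mu> @ [0]) = shifted_diagram \<mu>"
proof -
  have "(i, j) \<in> shifted_diagram (\<mu> @ [0]) \<longleftrightarrow> (i, j) \<in> shifted_diagram \<mu>" for i j
    by (cases "i = Suc (length \<mu>)") (auto simp: shifted_diagram_def nth_append)
  thus ?thesis by auto
qed

lemma shifted_syt_snoc_0: "shifted_syt (\<mu> @ [0]) = shifted_syt \<mu>"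
  by (simp add: shifted_syt_def shifted_diagram_snoc_0)

text \<open>Row \<open>Suc k\<close> starts in column \<open>Suc k\<close>, so its
  \<open>\<mu> ! k\<close> cells end in column \<open>\<mu> ! k + k\<close>.\<close>

definition row_end :: "nat list \<Rightarrow> nat \<Rightarrow> nat \<times> nat" where
  "row_end \<mu> k = (Suc k, \<mu> ! k + k)"

lemma row_end_in:
  assumes "strict_partition \<mu>" "k < length \<mu>" shows "row_end \<mu> k \<in> shifted_diagram \<mu>"
  using strict_partition_nth(2)[OF assms] assms(2) by (auto simp: shifted_diagram_def row_end_def)

lemma shifted_diagram_remove:
  assumes "strict_partition \<mu>" "k < length \<mu>"
  shows "shifted_diagram (\<mu>[k := \<mu> ! k - 1]) = shifted_diagram \<mu> - {row_end \<mu> k}"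
proof -
  have pos: "0 < \<mu> ! k" using strict_partition_nth(2)[OF assms] .
  have "(i, j) \<in> shifted_diagram (\<mu>[k := \<mu> ! k - 1]) \<longleftrightarrow>
      (i, j) \<in> shifted_diagram \<mu> - {row_end \<mu> k}" for i j
    using pos assms(2) by (cases "i = Suc k") (auto simp: shifted_diagram_def row_end_def nth_list_update)
  thus ?thesis by auto
qed

lemma corner_row: "(Suc k, j) \<in> shifted_diagram \<mu> \<Longrightarrow> j \<le> \<mu> ! k + k"
  by (auto simp: shifted_diagram_def)

lemma strictly_decreasing_gap:
  fixes \<nu> :: "nat list"
  assumes "sorted_wrt (>) \<nu>" "i \<le> j" "j < length \<nu>"
  shows "\<nu> ! j + (j - i) \<le> \<nu> ! i"
  using assms(2,3)
proof (induction j rule: dec_induct)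
  case (step j)
  have "\<nu> ! Suc j < \<nu> ! j" using sorted_wrt_nth_less[OF assms(1), of j "Suc j"] step.prems by simp
  thus ?case using step by simp
qed simp

text \<open>In the list with part \<open>k\<close> lowered, the end columns of the rows still
  decrease weakly by \<open>strictly_decreasing_gap\<close>; so every row below ends before the
  column of the corner.\<close>

lemma corner_column:
  assumes "strict_partition \<mu>" "k \<in> corners \<mu>" "(i, \<mu> ! k + k) \<in> shifted_diagram \<mu>"
  shows "i \<le> Suc k"
proof (rule ccontr)
  assume "\<not> i \<le> Suc k"
  then obtain l where l: "i = Suc l" "k < l" by (cases i) auto
  have len: "l < length \<mu>" "k < length \<mu>" and j: "\<mu> ! k + k \<le> \<mu> ! l + l"
    using assms(3) l by (auto simp: shifted_diagram_def)
  have "\<mu> ! l + (l - k) \<le> \<mu> ! k - 1"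
    using strictly_decreasing_gap[of "\<mu>[k := \<mu> ! k - 1]" k l] assms(2) l len
    by (simp add: corners_def)
  thus False using j l strict_partition_nth(2)[OF assms(1) len(2)] by linarith
qed

lemma shifted_syt_max:
  assumes \<mu>: "strict_partition \<mu>" "\<mu> \<noteq> []" and T: "T \<in> shifted_syt \<mu>"
  shows "\<exists>k\<in>corners \<mu>. T (row_end \<mu> k) = sum_list \<mu>"
proof -
  let ?N = "sum_list \<mu>"
  have bij: "bij_betw T (shifted_diagram \<mu>) {1..?N}" using T by (simp add: shifted_syt_def)
  have row: "T (i, j) < T (i, j')"
    if "(i, j) \<in> shifted_diagram \<mu>" "(i, j') \<in> shifted_diagram \<mu>" "j < j'" for i j j'
    using T that by (auto simp: shifted_syt_def)
  have column: "T (i, j) < T (i', j)"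
    if "(i, j) \<in> shifted_diagram \<mu>" "(i', j) \<in> shifted_diagram \<mu>" "i < i'" for i i' j
    using T that by (auto simp: shifted_syt_def)
  have le: "T x \<le> ?N" if "x \<in> shifted_diagram \<mu>" for x
    using bij that by (auto simp: bij_betw_def)
  have "?N \<ge> 1" using \<mu> by (cases \<mu>) (auto simp: strict_partition_def)
  hence "?N \<in> T ` shifted_diagram \<mu>" using bij by (simp add: bij_betw_def)
  then obtain i j where ij: "(i, j) \<in> shifted_diagram \<mu>" "T (i, j) = ?N" by auto
  define k where "k = i - 1"
  have k: "i = Suc k" "k < length \<mu>" "i \<le> j" "j \<le> \<mu> ! k + k"
    using ij(1) by (auto simp: shifted_diagram_def k_def)
  have "j = \<mu> ! k + k"
  proof (rule ccontr)
    assume "j \<noteq> \<mu> ! k + k"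
    hence "(i, Suc j) \<in> shifted_diagram \<mu>" using k by (auto simp: shifted_diagram_def)
    thus False using row[OF ij(1), of "Suc j"] le[of "(i, Suc j)"] ij(2) by simp
  qed
  moreover have "k \<in> corners \<mu>"
  proof (rule ccontr)
    assume "k \<notin> corners \<mu>"
    hence l: "Suc k < length \<mu>" "\<not> \<mu> ! Suc k < \<mu> ! k - 1" using corners_iff[OF \<mu>(1) k(2)] by auto
    have "\<mu> ! Suc k < \<mu> ! k" "0 < \<mu> ! Suc k" using strict_partition_nth[OF \<mu>(1)] l(1) by auto
    \<comment> \<open>The next row is shorter by exactly one and starts one column later, so it ends
      in the same column and the cell below exists.\<close>
    hence "(Suc i, j) \<in> shifted_diagram \<mu>"
      using l k \<open>j = \<mu> ! k + k\<close> by (auto simp: shifted_diagram_def)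
    thus False using column[OF ij(1), of "Suc i"] le[of "(Suc i, j)"] ij(2) by simp
  qed
  ultimately show ?thesis using ij(2) k(1) by (auto simp: row_end_def)
qed

lemma finite_shifted_diagram: "finite (shifted_diagram \<mu>)"
proof (rule finite_subset)
  show "shifted_diagram \<mu> \<subseteq> Sigma {1..length \<mu>} (\<lambda>i. {i..\<mu> ! (i - 1) + i - 1})"
    by (auto simp: shifted_diagram_def)
qed simp

lemma finite_shifted_syt: "finite (shifted_syt \<mu>)"
proof (rule finite_subset)
  show "shifted_syt \<mu> \<subseteq> shifted_diagram \<mu> \<rightarrow>\<^sub>E {1..sum_list \<mu>}"
    by (auto simp: shifted_syt_def PiE_def bij_betw_def)
qed (intro finite_PiE finite_shifted_diagram; simp)

text \<open>The largest entry is deleted and put back. The corner is last in its row and in its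
  column, so putting it back violates no inequality.\<close>

lemma card_shifted_syt_corner:
  assumes \<mu>: "strict_partition \<mu>" and k: "k \<in> corners \<mu>"
  shows "card {T \<in> shifted_syt \<mu>. T (row_end \<mu> k) = sum_list \<mu>} =
    card (shifted_syt (\<mu>[k := \<mu> ! k - 1]))"
proof -
  let ?\<mu> = "\<mu>[k := \<mu> ! k - 1]" and ?x = "row_end \<mu> k"
  let ?S = "{T \<in> shifted_syt \<mu>. T ?x = sum_list \<mu>}"
  define D where "D = shifted_diagram \<mu>"
  have klen: "k < length \<mu>" using k by (simp add: corners_def)
  note sum = sum_list_remove[OF \<mu> klen]
  have D': "shifted_diagram ?\<mu> = D - {?x}" using shifted_diagram_remove[OF \<mu> klen] by (simp add: D_def)
  have x: "?x \<in> D" using row_end_in[OF \<mu> klen] by (simp add: D_def)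
  have restrict: "restrict T (D - {?x}) \<in> shifted_syt ?\<mu>" if T: "T \<in> ?S" for T
  proof -
    have "bij_betw T D {1..sum_list \<mu>}" "T ?x = sum_list \<mu>"
      using T by (auto simp: shifted_syt_def D_def)
    hence "bij_betw T (D - {?x}) ({1..sum_list \<mu>} - {sum_list \<mu>})"
      using x sum bij_betw_DiffI[of T D "{1..sum_list \<mu>}" "{?x}" "{sum_list \<mu>}"]
      by (auto simp: bij_betw_singletonI)
    moreover have "{1..sum_list \<mu>} - {sum_list \<mu>} = {1..sum_list ?\<mu>}" using sum by auto
    ultimately have "bij_betw (restrict T (D - {?x})) (D - {?x}) {1..sum_list ?\<mu>}"
      by (simp add: bij_betw_restrict_eq)
    thus ?thesis using T unfolding shifted_syt_def D' D_def[symmetric] by auto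
  qed
  have extend: "T(?x := sum_list \<mu>) \<in> ?S" if T: "T \<in> shifted_syt ?\<mu>" for T
  proof -
    let ?T = "T(?x := sum_list \<mu>)"
    have ext: "T \<in> extensional (D - {?x})" and bij: "bij_betw T (D - {?x}) {1..sum_list ?\<mu>}"
      and row: "\<And>i j j'. (i, j) \<in> D - {?x} \<Longrightarrow> (i, j') \<in> D - {?x} \<Longrightarrow> j < j' \<Longrightarrow> T (i, j) < T (i, j')"
      and col: "\<And>i i' j. (i, j) \<in> D - {?x} \<Longrightarrow> (i', j) \<in> D - {?x} \<Longrightarrow> i < i' \<Longrightarrow> T (i, j) < T (i', j)"
      using T unfolding shifted_syt_def D' by blast+
    have lt: "T y < sum_list \<mu>" if "y \<in> D - {?x}" for y
    proof -
      have "T y \<in> {1..sum_list ?\<mu>}" using bij_betwE[OF bij] that by blast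
      thus ?thesis unfolding sum by simp
    qed
    have "bij_betw ?T (insert ?x (D - {?x})) (insert (sum_list \<mu>) {1..sum_list ?\<mu>})"
    proof -
      have "bij_betw ?T (D - {?x}) {1..sum_list ?\<mu>}"
        using bij by (subst bij_betw_cong[of _ _ T]) auto
      moreover have "sum_list \<mu> \<notin> {1..sum_list ?\<mu>}" using sum by simp
      ultimately show ?thesis
        using notIn_Un_bij_betw3[of ?x "D - {?x}" ?T "{1..sum_list ?\<mu>}"] by simp
    qed
    moreover have "insert ?x (D - {?x}) = D" using x by auto
    moreover have "insert (sum_list \<mu>) {1..sum_list ?\<mu>} = {1..sum_list \<mu>}" using sum by auto
    ultimately have "bij_betw ?T D {1..sum_list \<mu>}" by simp
    moreover have "?T \<in> extensional D" using ext x by (auto simp: extensional_def)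
    moreover have "?T (i, j) < ?T (i, j')" if "(i, j) \<in> D" "(i, j') \<in> D" "j < j'" for i j j'
    proof -
      have "(i, j) \<noteq> ?x" using corner_row[of k j' \<mu>] that by (auto simp: row_end_def D_def)
      thus ?thesis using row[of i j j'] lt[of "(i, j)"] that by auto
    qed
    moreover have "?T (i, j) < ?T (i', j)" if "(i, j) \<in> D" "(i', j) \<in> D" "i < i'" for i i' j
    proof -
      have "(i, j) \<noteq> ?x" using corner_column[OF \<mu> k, of i'] that by (auto simp: row_end_def D_def)
      thus ?thesis using col[of i j i'] lt[of "(i, j)"] that by auto
    qed
    ultimately show ?thesis unfolding shifted_syt_def D_def[symmetric] by simp
  qed
  have "bij_betw (\<lambda>T. restrict T (D - {?x})) ?S (shifted_syt ?\<mu>)"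
  proof (rule bij_betw_byWitness[where f' = "\<lambda>T. T(?x := sum_list \<mu>)"])
    show "\<forall>T\<in>?S. (restrict T (D - {?x}))(?x := sum_list \<mu>) = T"
      by (auto simp: fun_eq_iff shifted_syt_def extensional_def D_def restrict_def)
    show "\<forall>T\<in>shifted_syt ?\<mu>. restrict (T(?x := sum_list \<mu>)) (D - {?x}) = T"
      unfolding shifted_syt_def D' by (auto simp: fun_eq_iff extensional_def restrict_def)
  qed (use restrict extend in blast)+
  thus ?thesis by (rule bij_betw_same_card)
qed

lemma corner_recursive_num_shifted_syt: "corner_recursive num_shifted_syt"
  unfolding corner_recursive_def
proof (intro conjI allI impI)
  fix \<mu> assume \<mu>: "strict_partition \<mu>" "\<mu> \<noteq> []"
  let ?S = "\<lambda>k. {T \<in> shifted_syt \<mu>. T (row_end \<mu> k) = sum_list \<mu>}"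
  have "shifted_syt \<mu> = (\<Union>k\<in>corners \<mu>. ?S k)" using shifted_syt_max[OF \<mu>] by blast
  hence "num_shifted_syt \<mu> = card (\<Union>k\<in>corners \<mu>. ?S k)" by (simp add: num_shifted_syt_def)
  also have "\<dots> = (\<Sum>k\<in>corners \<mu>. card (?S k))"
  proof (rule card_UN_disjoint; (intro ballI impI)?)
    show "finite (corners \<mu>)" by (simp add: corners_def)
    show "finite (?S k)" for k using finite_shifted_syt by simp
    fix i j assume ij: "i \<in> corners \<mu>" "j \<in> corners \<mu>" "i \<noteq> j"
    have "row_end \<mu> i \<in> shifted_diagram \<mu>" "row_end \<mu> j \<in> shifted_diagram \<mu>" "row_end \<mu> i \<noteq> row_end \<mu> j"
      using ij row_end_in[OF \<mu>(1)] by (auto simp: corners_def row_end_def)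
    thus "?S i \<inter> ?S j = {}" by (auto simp: shifted_syt_def bij_betw_def inj_on_def)
  qed
  also have "\<dots> = (\<Sum>k\<in>corners \<mu>. num_shifted_syt (\<mu>[k := \<mu> ! k - 1]))"
    by (simp add: card_shifted_syt_corner[OF \<mu>(1)] num_shifted_syt_def)
  finally show "num_shifted_syt \<mu> = (\<Sum>k\<in>corners \<mu>. num_shifted_syt (\<mu>[k := \<mu> ! k - 1]))" .
qed (simp add: num_shifted_syt_def shifted_syt_snoc_0)

lemma num_shifted_syt_Nil: "num_shifted_syt [] = 1"
proof -
  have "shifted_diagram [] = {}" by (auto simp: shifted_diagram_def)
  hence "shifted_syt [] = {\<lambda>_. undefined}" by (auto simp: shifted_syt_def bij_betw_def)
  thus ?thesis by (simp add: num_shifted_syt_def)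
qed

lemma card_comm_class_rows_word:
  assumes "sorted_wrt (>) \<mu>" shows "card (comm_class (rows_word \<mu>)) = num_shifted_syt \<mu>"
proof -
  have "comm_class [] = {[]}" using comm_eq_length by (fastforce simp: comm_class_def)
  thus ?thesis
    using corner_recursive_unique[OF corner_recursive_comm_class corner_recursive_num_shifted_syt _ assms]
      num_shifted_syt_Nil by simp
qed

lemma num_shifted_syt_eq:
  assumes "sorted_wrt (>) \<mu>" shows "real (num_shifted_syt \<mu>) = shifted_count \<mu>"
proof (rule corner_recursive_unique[OF _ corner_recursive_shifted_count _ assms])
  show "corner_recursive (\<lambda>\<mu>. real (num_shifted_syt \<mu>))"
    using corner_recursive_num_shifted_syt by (simp add: corner_recursive_def)
  show "real (num_shifted_syt []) = shifted_count []"
    by (simp add: num_shifted_syt_Nil shifted_count_def)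
qed

text \<open>Reversing the words turns the chains into rows of lengths \<open>n, ..., m + 1\<close>;
  their number \<open>n - m\<close> is the summation index of the final recurrence.\<close>

lemma card_comm_class_desc_block:
  "card (comm_class (desc_block m n)) = num_shifted_syt (map (\<lambda>j. n - j) [0..<n - m])"
proof -
  have rows: "rev [Suc m..<Suc n] = map (\<lambda>j. n - j) [0..<n - m]"
    by (rule nth_equalityI) (auto simp: rev_nth simp del: upt_Suc)
  have "sorted_wrt (>) (rev [Suc m..<Suc n])"
    by (simp add: sorted_wrt_rev del: upt_Suc)
  thus ?thesis
    using card_comm_class_rev[of "desc_block m n"] card_comm_class_rows_word
    unfolding rev_desc_block rows by simp
qed

theorem theorem4p13:
  shows "gc 0 = 1 \<and> gc 1 = 1 \<and>
    (\<forall>n\<ge>2. gc n = (\<Sum>i = 1..n. num_shifted_syt (map (\<lambda>j. n - j) [0..<i]) * gc (n - i))) \<and>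
    (\<forall>\<mu>. strict_partition \<mu> \<longrightarrow>
       real (num_shifted_syt \<mu>) =
         fact (sum_list \<mu>) / (\<Prod>i<length \<mu>. fact (\<mu> ! i)) *
         (\<Prod>(i, j) \<in> {(i, j). i < j \<and> j < length \<mu>}.
            (real (\<mu> ! i) - real (\<mu> ! j)) / (real (\<mu> ! i) + real (\<mu> ! j))))"
proof (intro conjI allI impI)
  show "gc 0 = 1" by (rule gc_0)
  show "gc 1 = 1" by (rule gc_1)
  fix n :: nat assume "2 \<le> n"
  hence "gc n = (\<Sum>m<n. num_shifted_syt (map (\<lambda>j. n - j) [0..<n - m]) * gc m)"
    by (simp add: gc_recurrence card_comm_class_desc_block)
  also have "\<dots> = (\<Sum>i = 1..n. num_shifted_syt (map (\<lambda>j. n - j) [0..<i]) * gc (n - i))"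
    by (rule sum.reindex_bij_witness[of _ "\<lambda>i. n - i" "\<lambda>m. n - m"]) auto
  finally show "gc n = (\<Sum>i = 1..n. num_shifted_syt (map (\<lambda>j. n - j) [0..<i]) * gc (n - i))" .
next
  fix \<mu> assume "strict_partition \<mu>"
  thus "real (num_shifted_syt \<mu>) =
      fact (sum_list \<mu>) / (\<Prod>i<length \<mu>. fact (\<mu> ! i)) *
      (\<Prod>(i, j) \<in> {(i, j). i < j \<and> j < length \<mu>}.
        (real (\<mu> ! i) - real (\<mu> ! j)) / (real (\<mu> ! i) + real (\<mu> ! j)))"
    using num_shifted_syt_eq by (simp only: strict_partition_def shifted_count_def)
qed

end
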